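(* Let $\mathcal D=\{g_s:s\in\mathcal M\}$ be a Parseval determining set for $L^1(X)$, let $\{\mathcal N_\delta\}_{\delta\in\Delta}$ be a family (with arbitrary index set $\Delta$) of finitely generated MI spaces in $L^2(X;\mathcal H)$, and for $\delta,\theta\in\Delta$ put $\mathcal N_{\delta,\theta}:=\mathcal N_\delta+\mathcal N_\theta=\{u+v:u\in\mathcal N_\delta,v\in\mathcal N_\theta\}$. Let $\mathcal A=\{\psi_i\}_{i\in I}$ be a sequence in $L^2(X;\mathcal H)$ such that $\mathcal E_{\mathcal D}(\mathcal A)$ is Bessel, and suppose that $$\mathfrak S(\mathcal N_\delta,\mathcal N_\theta)<1\quad\text{for every }\delta,\theta\in\Delta\text{ with }\delta\neq\theta.$$ For $\delta,\theta\in\Delta$ let $\mathcal A'_{\delta,\theta}$ be a finite set of generators for $\mathcal N_{\delta,\theta}$. Then the sampling operator $T$ associated with $\mathcal E_{\mathcal D}(\mathcal A)$ is one-to-one for $\bigcup_{\delta,\theta\in\Delta}\mathcal N_{\delta,\theta}$ if and only if $$\dim\big(\operatorname{range}G_{\mathcal A'_{\delta,\theta},\mathcal A}(x)\big)=\dim J_{\mathcal A'_{\delta,\theta}}(x)\quad\text{for a.e. }x\in X\text{ and all }\delta,\theta\in\Delta.$$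
   Context: $(X,\mu_X)$ is a $\sigma$-finite complete measure space with $L^2(X)$ separable, $\mathcal H$ is a separable Hilbert space, and $L^2(X;\mathcal H)$ is the Hilbert space of (classes of) measurable $\varphi:X\to\mathcal H$ with $\int_X\|\varphi(x)\|^2\,d\mu_X(x)<\infty$. For $\phi\in L^\infty(X)$, $(M_\phi f)(x)=\phi(x)f(x)$ on $L^2(X;\mathcal H)$. Parseval determining set: let $(\mathcal M,\mu_{\mathcal M})$ be a $\sigma$-finite measure space. A set $\mathcal D=\{g_s\in L^\infty(X): s\in\mathcal M\}$ is a Parseval determining set for $L^1(X)$ if for each $f\in L^1(X)$ the map $s\mapsto\int_X f(x)\overline{g_s(x)}\,d\mu_X(x)$ is measurable on $\mathcal M$ and $\int_{\mathcal M}\big|\int_X f\,\overline{g_s}\,d\mu_X\big|^2 d\mu_{\mathcal M}(s)=\int_X|f|^2\,d\mu_X$. A closed subspace $V\subset L^2(X;\mathcal H)$ is multiplication invariant (MI) if $M_\phi f\in V$ for all $\phi\in\mathcal D$, $f\in V$. For $\mathcal A\subset L^2(X;\mathcal H)$: $\mathcal E_{\mathcal D}(\mathcal A)=\{M_\phi\varphi:\phi\in\mathcal D,\varphi\in\mathcal A\}$, $\mathcal S_{\mathcal D}(\mathcal A)=\overline{\operatorname{span}}\,\mathcal E_{\mathcal D}(\mathcal A)$. An MI space $V$ is finitely generated if $V=\mathcal S_{\mathcal D}(\mathcal B)$ for a finite $\mathcal B$, called a finite set of generators for $V$. $\mathcal E_{\mathcal D}(\mathcal A)$ is Bessel if there is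 $M>0$ with $\sum_{i\in I}\int_{\mathcal M}|\langle f,M_{g_s}\psi_i\rangle|^2d\mu_{\mathcal M}(s)\le M\|f\|^2$ for all $f\in L^2(X;\mathcal H)$. The sampling operator of $\mathcal E_{\mathcal D}(\mathcal A)$ is $T:L^2(X;\mathcal H)\to L^2(\mathcal M\times I)$, $Tf=\{\langle f,M_{g_t}\psi_i\rangle\}_{t\in\mathcal M,i\in I}$. For a countable family $\mathcal B$, $J_{\mathcal B}(x)=\overline{\operatorname{span}}\{\varphi(x):\varphi\in\mathcal B\}$. For a finite $\mathcal B=\{\phi_1,\dots,\phi_r\}$, $G_{\mathcal B,\mathcal A}(x):\mathbb C^r\to\ell^2(I)$ is the mixed Gramian with matrix $[\langle\phi_j(x),\psi_i(x)\rangle]_{i\in I,\,1\le j\le r}$ (row $i$, column $j$), which is bounded for a.e. $x$ by the Bessel property. For closed subspaces $E,F$ of a Hilbert space, $\mathfrak S(E,F)=\sup\{\|P_Fu\|/\|u\|: u\in E\setminus\{0\}\}=\|P_F|_E\|$, with $P_F$ the orthogonal projection onto $F$; it is $0$ if $E=\{0\}$ or $F=\{0\}$.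
   Formalization: "One-to-one for the union of the N_{δ,θ}" is read as injectivity of T on each N_{δ,θ} separately; injectivity on the union as a set fails for three coordinate lines in C^3 with ker T spanned by (1,1,1). The null set of x may depend on the pair (δ,θ). *)

theory Defs
  imports "HOL-Analysis.Analysis" "HOL-Library.Function_Algebras"
begin

class complex_vector = ab_group_add +
  fixes scaleC :: "complex \<Rightarrow> 'a \<Rightarrow> 'a"  (infixr "*\<^sub>C" 75)
  assumes scaleC_add_right: "c *\<^sub>C (x + y) = c *\<^sub>C x + c *\<^sub>C y"
    and scaleC_add_left: "(c + d) *\<^sub>C x = c *\<^sub>C x + d *\<^sub>C x"
    and scaleC_scaleC: "c *\<^sub>C d *\<^sub>C x = (c * d) *\<^sub>C x"
    and scaleC_one: "1 *\<^sub>C x = x"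

interpretation complex_vector: vector_space "scaleC :: complex \<Rightarrow> 'a \<Rightarrow> 'a::complex_vector"
  by unfold_locales
    (simp_all add: scaleC_add_right scaleC_add_left scaleC_scaleC scaleC_one)

abbreviation "csubspace \<equiv> complex_vector.subspace"
abbreviation "cspan \<equiv> complex_vector.span"
abbreviation "cdim \<equiv> complex_vector.dim"

instantiation "fun" :: (type, complex_vector) complex_vector
begin

definition scaleC_fun where "c *\<^sub>C f = (\<lambda>x. c *\<^sub>C f x)"

instance
  by standard
    (simp_all add: scaleC_fun_def fun_eq_iff scaleC_add_right scaleC_add_left
      scaleC_scaleC scaleC_one)

end

text \<open>Complex Hilbert spaces; the inner product is linear in the first argument.\<close>

class complex_hilbert = complex_vector + banach +
  fixes cinner :: "'a \<Rightarrow> 'a \<Rightarrow> complex"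
  assumes scaleR_scaleC: "r *\<^sub>R x = complex_of_real r *\<^sub>C x"
    and cinner_commute: "cinner x y = cnj (cinner y x)"
    and cinner_add_left: "cinner (x + y) z = cinner x z + cinner y z"
    and cinner_scaleC_left: "cinner (c *\<^sub>C x) y = c * cinner x y"
    and cinner_self: "cinner x x = complex_of_real ((norm x)\<^sup>2)"

instantiation complex :: complex_hilbert
begin

definition scaleC_complex :: "complex \<Rightarrow> complex \<Rightarrow> complex"
  where "scaleC_complex = (*)"

definition cinner_complex :: "complex \<Rightarrow> complex \<Rightarrow> complex"
  where "cinner_complex x y = x * cnj y"

instance
  by standard
    (simp_all add: scaleC_complex_def cinner_complex_def algebra_simps scaleR_conv_of_real
      complex_norm_square del: of_real_power)

end

text \<open>
  Elements of \<open>L\<^sup>2(M; 'h)\<close> are represented by functions.  Equality of classes is equality almost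
  everywhere, and a set of classes is represented by a set of functions.  A set that is closed
  in the \<open>L\<^sup>2\<close> seminorm is automatically invariant under changes on null sets.
  Borel measurability is the right notion because \<open>'h\<close> is separable.
\<close>

definition L2 :: "'x measure \<Rightarrow> ('x \<Rightarrow> 'h::{complex_hilbert, second_countable_topology}) set"
  where "L2 M = {f. f \<in> borel_measurable M \<and> integrable M (\<lambda>x. (norm (f x))\<^sup>2)}"

definition L2_inner :: "'x measure \<Rightarrow> ('x \<Rightarrow> 'h::complex_hilbert) \<Rightarrow> ('x \<Rightarrow> 'h) \<Rightarrow> complex"
  where "L2_inner M f h = (LINT x|M. cinner (f x) (h x))"

definition L2_norm :: "'x measure \<Rightarrow> ('x \<Rightarrow> 'h::real_normed_vector) \<Rightarrow> real"
  where "L2_norm M f = sqrt (LINT x|M. (norm (f x))\<^sup>2)"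

definition L2_closure ::
    "'x measure \<Rightarrow> ('x \<Rightarrow> 'h::{complex_hilbert, second_countable_topology}) set \<Rightarrow> ('x \<Rightarrow> 'h) set"
  where "L2_closure M S = {f \<in> L2 M. \<forall>\<epsilon>>0. \<exists>h\<in>S. L2_norm M (f - h) < \<epsilon>}"

definition L2_closed_subspace ::
    "'x measure \<Rightarrow> ('x \<Rightarrow> 'h::{complex_hilbert, second_countable_topology}) set \<Rightarrow> bool"
  where "L2_closed_subspace M V \<longleftrightarrow> V \<subseteq> L2 M \<and> csubspace V \<and> L2_closure M V = V"

text \<open>Separability of the scalar space \<open>L\<^sup>2(M)\<close>.\<close>

definition L2_separable :: "'x measure \<Rightarrow> bool"
  where "L2_separable M \<longleftrightarrow>
    (\<exists>S :: ('x \<Rightarrow> complex) set. countable S \<and> S \<subseteq> L2 M \<and> L2_closure M S = L2 M)"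

definition Linf :: "'x measure \<Rightarrow> ('x \<Rightarrow> complex) set"
  where "Linf M = {f. f \<in> borel_measurable M \<and> (\<exists>C. AE x in M. norm (f x) \<le> C)}"

text \<open>
  The set \<open>{g s | s. s \<in> space N}\<close> is a Parseval determining set for \<open>L\<^sup>1(M)\<close>.  Both sides of the
  identity are extended nonnegative integrals, since \<open>f\<close> need not be square integrable.
\<close>

definition parseval_determining ::
    "'x measure \<Rightarrow> 's measure \<Rightarrow> ('s \<Rightarrow> 'x \<Rightarrow> complex) \<Rightarrow> bool"
  where "parseval_determining M N g \<longleftrightarrow>
    (\<forall>s\<in>space N. g s \<in> Linf M) \<and>
    (\<forall>f. integrable M f \<longrightarrow>
      (\<lambda>s. LINT x|M. f x * cnj (g s x)) \<in> borel_measurable N \<and>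
      (\<integral>\<^sup>+ s. ennreal ((norm (LINT x|M. f x * cnj (g s x)))\<^sup>2) \<partial>N) =
        (\<integral>\<^sup>+ x. ennreal ((norm (f x))\<^sup>2) \<partial>M))"

definition mult_op :: "('x \<Rightarrow> complex) \<Rightarrow> ('x \<Rightarrow> 'h::complex_vector) \<Rightarrow> 'x \<Rightarrow> 'h"
  where "mult_op \<phi> f = (\<lambda>x. \<phi> x *\<^sub>C f x)"

definition MI_space ::
    "'x measure \<Rightarrow> ('x \<Rightarrow> complex) set \<Rightarrow>
      ('x \<Rightarrow> 'h::{complex_hilbert, second_countable_topology}) set \<Rightarrow> bool"
  where "MI_space M D V \<longleftrightarrow>
    L2_closed_subspace M V \<and> (\<forall>\<phi>\<in>D. \<forall>f\<in>V. mult_op \<phi> f \<in> V)"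

definition MI_system ::
    "('x \<Rightarrow> complex) set \<Rightarrow> ('x \<Rightarrow> 'h::complex_vector) set \<Rightarrow> ('x \<Rightarrow> 'h) set"
  where "MI_system D A = {mult_op \<phi> f | \<phi> f. \<phi> \<in> D \<and> f \<in> A}"

definition MI_span ::
    "'x measure \<Rightarrow> ('x \<Rightarrow> complex) set \<Rightarrow>
      ('x \<Rightarrow> 'h::{complex_hilbert, second_countable_topology}) set \<Rightarrow> ('x \<Rightarrow> 'h) set"
  where "MI_span M D A = L2_closure M (cspan (MI_system D A))"

definition finite_generators ::
    "'x measure \<Rightarrow> ('x \<Rightarrow> complex) set \<Rightarrow>
      ('x \<Rightarrow> 'h::{complex_hilbert, second_countable_topology}) set \<Rightarrow> ('x \<Rightarrow> 'h) set \<Rightarrow> bool"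
  where "finite_generators M D B V \<longleftrightarrow> finite B \<and> B \<subseteq> L2 M \<and> V = MI_span M D B"

definition finitely_generated_MI ::
    "'x measure \<Rightarrow> ('x \<Rightarrow> complex) set \<Rightarrow>
      ('x \<Rightarrow> 'h::{complex_hilbert, second_countable_topology}) set \<Rightarrow> bool"
  where "finitely_generated_MI M D V \<longleftrightarrow>
    MI_space M D V \<and> (\<exists>B. finite_generators M D B V)"

definition sum_space :: "('x \<Rightarrow> 'h::ab_group_add) set \<Rightarrow> ('x \<Rightarrow> 'h) set \<Rightarrow> ('x \<Rightarrow> 'h) set"
  where "sum_space V W = {u + v | u v. u \<in> V \<and> v \<in> W}"

definition MI_bessel ::
    "'x measure \<Rightarrow> 's measure \<Rightarrow> ('s \<Rightarrow> 'x \<Rightarrow> complex) \<Rightarrow> 'i set \<Rightarrow>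
      ('i \<Rightarrow> 'x \<Rightarrow> 'h::{complex_hilbert, second_countable_topology}) \<Rightarrow> bool"
  where "MI_bessel M N g I \<psi> \<longleftrightarrow>
    (\<exists>C>0. \<forall>f\<in>L2 M.
      (\<Sum>\<^sub>\<infinity>i\<in>I. \<integral>\<^sup>+ s. ennreal ((norm (L2_inner M f (mult_op (g s) (\<psi> i))))\<^sup>2) \<partial>N)
        \<le> ennreal (C * (L2_norm M f)\<^sup>2))"

definition sampling_op ::
    "'x measure \<Rightarrow> ('s \<Rightarrow> 'x \<Rightarrow> complex) \<Rightarrow> ('i \<Rightarrow> 'x \<Rightarrow> 'h::complex_hilbert) \<Rightarrow>
      ('x \<Rightarrow> 'h) \<Rightarrow> 's \<times> 'i \<Rightarrow> complex"
  where "sampling_op M g \<psi> f = (\<lambda>(t, i). L2_inner M f (mult_op (g t) (\<psi> i)))"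

text \<open>
  A linear operator \<open>T\<close> into the \<open>L\<^sup>2\<close> space of \<open>P\<close> is one-to-one for a union of subspaces when it
  is injective on each member of the union; equivalently, the union meets the kernel of \<open>T\<close> only
  in \<open>0\<close>.  Vectors from different members are not compared.  Injectivity of \<open>T\<close> as a map on the
  set-theoretic union of the sums \<open>V\<^sub>1 + V\<^sub>2\<close> would involve fourfold sums, and no condition on the
  individual sums characterizes it: take the three coordinate lines in \<open>\<complex>\<^sup>3\<close> and an operator
  whose kernel is spanned by \<open>(1, 1, 1)\<close>.
\<close>

definition one_to_one_for ::
    "'x measure \<Rightarrow> 'p measure \<Rightarrow> (('x \<Rightarrow> 'h) \<Rightarrow> 'p \<Rightarrow> complex) \<Rightarrow> ('x \<Rightarrow> 'h) set set \<Rightarrow> bool"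
  where "one_to_one_for M P T \<V> \<longleftrightarrow>
    (\<forall>V\<in>\<V>. \<forall>f\<in>V. \<forall>h\<in>V. (AE p in P. T f p = T h p) \<longrightarrow> (AE x in M. f x = h x))"

definition fibre_space :: "('x \<Rightarrow> 'h::complex_hilbert) set \<Rightarrow> 'x \<Rightarrow> 'h set"
  where "fibre_space B x = closure (cspan ((\<lambda>\<phi>. \<phi> x) ` B))"

text \<open>
  The mixed Gramian at \<open>x\<close> as an operator from \<open>\<complex>\<^sup>r\<close> to \<open>\<ell>\<^sup>2(I)\<close>, where \<open>r = length \<phi>s\<close>.  Only the
  first \<open>r\<close> entries of the argument matter, and vectors indexed by \<open>I\<close> are extended by \<open>0\<close>.
\<close>

definition mixed_gramian ::
    "('x \<Rightarrow> 'h::complex_hilbert) list \<Rightarrow> 'i set \<Rightarrow> ('i \<Rightarrow> 'x \<Rightarrow> 'h) \<Rightarrow> 'x \<Rightarrow>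
      (nat \<Rightarrow> complex) \<Rightarrow> 'i \<Rightarrow> complex"
  where "mixed_gramian \<phi>s I \<psi> x c =
    (\<lambda>i. if i \<in> I then \<Sum>j<length \<phi>s. cinner ((\<phi>s ! j) x) (\<psi> i x) * c j else 0)"

text \<open>The orthogonal projection onto a closed subspace, determined up to null sets.\<close>

definition L2_proj ::
    "'x measure \<Rightarrow> ('x \<Rightarrow> 'h::complex_hilbert) set \<Rightarrow> ('x \<Rightarrow> 'h) \<Rightarrow> 'x \<Rightarrow> 'h"
  where "L2_proj M F u = (SOME v. v \<in> F \<and> (\<forall>w\<in>F. L2_inner M (u - v) w = 0))"

definition L2_trivial :: "'x measure \<Rightarrow> ('x \<Rightarrow> 'h::zero) set \<Rightarrow> bool"
  where "L2_trivial M E \<longleftrightarrow> (\<forall>u\<in>E. AE x in M. u x = 0)"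

text \<open>The supremum cosine angle between closed subspaces.\<close>

definition sup_cos_angle ::
    "'x measure \<Rightarrow> ('x \<Rightarrow> 'h::complex_hilbert) set \<Rightarrow> ('x \<Rightarrow> 'h) set \<Rightarrow> real"
  where "sup_cos_angle M E F =
    (if L2_trivial M E \<or> L2_trivial M F then 0
     else Sup {L2_norm M (L2_proj M F u) / L2_norm M u | u. u \<in> E \<and> \<not> (AE x in M. u x = 0)})"

end

theory Submission
  imports Defs
begin

text \<open>
  Every sum \<open>V\<close> of two of the spaces is itself the MI span of the finite set \<open>\<phi>\<^sub>1, \<dots>, \<phi>\<^sub>r\<close>
  chosen for it, and injectivity for a union means injectivity on each member.  So it suffices to
  show, for one such \<open>V\<close> with fibre spaces \<open>J(x)\<close>, that the sampling operator is injective on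
  \<open>V\<close> exactly if the mixed Gramian has rank \<open>dim J(x)\<close> almost everywhere
  (\<open>one_to_one_for_MI_span_iff\<close>).  Both conditions are brought into pointwise form.

  The range of the Gramian at \<open>x\<close> is the image of \<open>J(x)\<close> under \<open>v \<mapsto> (\<langle>v, \<psi>\<^sub>i(x)\<rangle>)\<^sub>i\<close>, so
  the rank condition says that no nonzero \<open>v \<in> J(x)\<close> is orthogonal to all \<open>\<psi>\<^sub>i(x)\<close>
  (\<open>cdim_range_mixed_gramian_iff\<close>).

  On the other side, a Parseval determining set detects integrable functions: orthogonality of
  \<open>f\<close> to all \<open>g\<^sub>s \<psi>\<close> means \<open>\<langle>f(x), \<psi>(x)\<rangle> = 0\<close> almost everywhere.  Hence \<open>f\<close> lies in the
  kernel of the sampling operator exactly if almost every \<open>f(x)\<close> is orthogonal to all \<open>\<psi>\<^sub>i(x)\<close>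
  (\<open>sampling_op_eq_iff\<close>), and the projection of \<open>L\<^sup>2\<close> onto an MI span acts fibrewise
  (\<open>MI_span_projection\<close>), so \<open>V\<close> consists of all \<open>f\<close> in \<open>L\<^sup>2\<close> with \<open>f(x) \<in> J(x)\<close> almost
  everywhere (\<open>MI_span_iff_fibre_space\<close>).

  Now fibrewise injectivity immediately gives injectivity on \<open>V\<close>.  For the converse one would
  have to select kernel vectors in the fibres measurably and square integrably;
  \<open>fibrewise_injective\<close> avoids this by projecting the \<open>\<psi>\<^sub>i\<close> onto \<open>V\<close> and showing that the
  fibres of these projections span those of \<open>V\<close>.

  The Hilbert space projection in \<open>L\<^sup>2\<close> (\<open>L2_projection_exists\<close>) is obtained from the
  parallelogram law and the completeness of \<open>L\<^sup>2\<close> for fast Cauchy sequences.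
\<close>

section \<open>Complex Hilbert spaces\<close>

lemma scaleC_minus1: "(-1) *\<^sub>C x = - (x::'a::complex_vector)"
  by (metis complex_vector.scale_minus_left scaleC_one)

lemma cinner_add_right: "cinner x (y + z) = cinner x y + cinner x (z::'h::complex_hilbert)"
  by (metis cinner_add_left cinner_commute complex_cnj_add)

lemma cinner_scaleC_right: "cinner x (c *\<^sub>C y) = cnj c * cinner x (y::'h::complex_hilbert)"
  by (metis cinner_commute cinner_scaleC_left complex_cnj_mult)

lemma cinner_zero_left [simp]: "cinner 0 (x::'h::complex_hilbert) = 0"
  using cinner_scaleC_left[of 0 0 x] by simp

lemma cinner_zero_right [simp]: "cinner (x::'h::complex_hilbert) 0 = 0"
  using cinner_scaleC_right[of x 0 0] by simp

lemma cinner_minus_left: "cinner (- x) y = - cinner x (y::'h::complex_hilbert)"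
  using cinner_scaleC_left[of "-1" x y] by (simp add: scaleC_minus1)

lemma cinner_diff_left: "cinner (x - y) z = cinner x z - cinner y (z::'h::complex_hilbert)"
  using cinner_add_left[of x "- y" z] by (simp add: cinner_minus_left)

lemma cinner_diff_right: "cinner x (y - z) = cinner x y - cinner x (z::'h::complex_hilbert)"
  by (metis cinner_commute cinner_diff_left complex_cnj_diff)

lemma cinner_eq_zero_iff: "cinner x x = 0 \<longleftrightarrow> x = (0::'h::complex_hilbert)"
  by (simp add: cinner_self)

lemma cinner_eq_zero_sym: "cinner x y = 0 \<longleftrightarrow> cinner y (x::'h::complex_hilbert) = 0"
  using cinner_commute[of x y] by auto

lemma norm_diff_scaleC_sq:
  "(norm (x - c *\<^sub>C y))\<^sup>2 =
    (norm x)\<^sup>2 - 2 * Re (cnj c * cinner x y) + (norm c)\<^sup>2 * (norm (y::'h::complex_hilbert))\<^sup>2"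
proof -
  have "complex_of_real ((norm (x - c *\<^sub>C y))\<^sup>2) =
      cinner x x - cnj c * cinner x y - c * cinner y x + c * cnj c * cinner y y"
    by (simp only: cinner_self[symmetric])
      (simp add: cinner_diff_left cinner_diff_right cinner_scaleC_left cinner_scaleC_right
        algebra_simps)
  also have "\<dots> = complex_of_real ((norm x)\<^sup>2) - (cnj c * cinner x y + cnj (cnj c * cinner x y)) +
      complex_of_real ((norm c)\<^sup>2) * complex_of_real ((norm y)\<^sup>2)"
    using cinner_commute[of y x]
    by (simp only: cinner_self complex_norm_square) simp
  also have "cnj c * cinner x y + cnj (cnj c * cinner x y) = complex_of_real (2 * Re (cnj c * cinner x y))"
    by (rule complex_add_cnj)
  finally show ?thesis
    by (simp only: of_real_eq_iff flip: of_real_mult of_real_diff of_real_add)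
qed

lemma norm_scaleC: "norm (c *\<^sub>C x) = norm c * norm (x::'h::complex_hilbert)"
  using norm_diff_scaleC_sq[of 0 c x]
  by (simp add: norm_minus_commute power_mult_distrib[symmetric])

text \<open>
  This is the optimization over the step length \<open>t\<close> in \<open>\<parallel>f - t\<langle>f, w\<rangle>w\<parallel>\<^sup>2\<close>, with
  \<open>a = |\<langle>f, w\<rangle>|\<^sup>2\<close> and \<open>b = \<parallel>w\<parallel>\<^sup>2\<close>.  For \<open>d = \<parallel>f\<parallel>\<^sup>2\<close> it gives the Cauchy--Schwarz
  inequality, for small \<open>d\<close> the near orthogonality of a near minimizer to \<open>w\<close>.
\<close>

lemma quadratic_bound:
  fixes a b d :: real
  assumes "\<And>t. 2 * t * a - t\<^sup>2 * a * b \<le> d" and "a \<ge> 0" and "b \<ge> 0"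
  shows "a \<le> d * b"
proof (cases "b = 0")
  case True
  have "a = 0"
  proof (rule ccontr)
    assume "a \<noteq> 0"
    then show False
      using assms(1)[of "(\<bar>d\<bar> + 1) / a"] True by simp
  qed
  then show ?thesis using True by simp
next
  case False
  then have "b > 0" using assms(3) by simp
  then have "2 * (1 / b) * a - (1 / b)\<^sup>2 * a * b = a / b"
    by (simp add: field_simps power2_eq_square)
  then have "a / b \<le> d" using assms(1)[of "1 / b"] by linarith
  then show ?thesis using \<open>b > 0\<close> by (simp add: field_simps)
qed

lemma norm_cinner_le: "norm (cinner x y) \<le> norm x * norm (y::'h::complex_hilbert)"
proof -
  have "(norm (cinner x y))\<^sup>2 \<le> (norm x)\<^sup>2 * (norm y)\<^sup>2"
  proof (rule quadratic_bound)
    fix t :: real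
    let ?c = "complex_of_real t * cinner x y"
    have "Re (cnj ?c * cinner x y) = t * (norm (cinner x y))\<^sup>2"
      by (simp add: cmod_power2) (simp add: power2_eq_square algebra_simps)
    moreover have "(norm ?c)\<^sup>2 = t\<^sup>2 * (norm (cinner x y))\<^sup>2"
      by (simp add: norm_mult power_mult_distrib)
    moreover have "0 \<le> (norm (x - ?c *\<^sub>C y))\<^sup>2" by simp
    ultimately show "2 * t * (norm (cinner x y))\<^sup>2 - t\<^sup>2 * (norm (cinner x y))\<^sup>2 * (norm y)\<^sup>2
        \<le> (norm x)\<^sup>2"
      using norm_diff_scaleC_sq[of x ?c y] by (simp add: algebra_simps)
  qed auto
  then have "(norm (cinner x y))\<^sup>2 \<le> (norm x * norm y)\<^sup>2" by (simp add: power_mult_distrib)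
  then show ?thesis by (rule power2_le_imp_le) simp
qed

lemma bounded_bilinear_cinner: "bounded_bilinear (cinner :: 'h \<Rightarrow> 'h::complex_hilbert \<Rightarrow> complex)"
proof
  show "\<exists>K. \<forall>a b. norm (cinner a (b::'h)) \<le> norm a * norm b * K"
    using norm_cinner_le by (metis mult.right_neutral)
qed (simp_all add: cinner_add_left cinner_add_right scaleR_scaleC cinner_scaleC_left
      cinner_scaleC_right scaleC_complex_def)

lemma bounded_bilinear_scaleC: "bounded_bilinear (scaleC :: complex \<Rightarrow> 'h \<Rightarrow> 'h::complex_hilbert)"
proof
  show "\<exists>K. \<forall>a b. norm (a *\<^sub>C (b::'h)) \<le> norm a * norm b * K"
    by (metis mult.right_neutral norm_scaleC order_refl)
qed (simp_all add: scaleC_add_left scaleC_add_right scaleR_scaleC scaleC_scaleC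
      scaleC_complex_def mult.commute)

lemma borel_measurable_cinner [measurable (raw)]:
  fixes f h :: "'x \<Rightarrow> 'h::{complex_hilbert, second_countable_topology}"
  assumes "f \<in> borel_measurable M" and "h \<in> borel_measurable M"
  shows "(\<lambda>x. cinner (f x) (h x)) \<in> borel_measurable M"
  using assms
  by (rule borel_measurable_continuous_Pair)
    (intro bounded_bilinear.continuous_on[OF bounded_bilinear_cinner] continuous_intros)

lemma borel_measurable_scaleC [measurable (raw)]:
  fixes f :: "'x \<Rightarrow> 'h::{complex_hilbert, second_countable_topology}"
  assumes "c \<in> borel_measurable M" and "f \<in> borel_measurable M"
  shows "(\<lambda>x. c x *\<^sub>C f x) \<in> borel_measurable M"
  using assms
  by (rule borel_measurable_continuous_Pair)
    (intro bounded_bilinear.continuous_on[OF bounded_bilinear_scaleC] continuous_intros)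

lemma orthogonal_cspan:
  fixes x :: "'h::complex_hilbert"
  assumes "\<And>b. b \<in> B \<Longrightarrow> cinner x b = 0" and "v \<in> cspan B"
  shows "cinner x v = 0"
  using assms(2)
  by (induction rule: complex_vector.span_induct_alt)
    (simp_all add: cinner_add_right cinner_scaleC_right assms(1))

lemma orthogonal_closure:
  fixes x :: "'h::complex_hilbert"
  assumes "\<And>b. b \<in> B \<Longrightarrow> cinner x b = 0" and "v \<in> closure B"
  shows "cinner x v = 0"
proof -
  have "closed {v. cinner x v = 0}"
    by (intro closed_Collect_eq bounded_bilinear.continuous_on[OF bounded_bilinear_cinner]
        continuous_intros)
  then have "closure B \<subseteq> {v. cinner x v = 0}"
    by (intro closure_minimal) (auto simp: assms(1))
  then show ?thesis using assms(2) by auto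
qed

lemma csubspace_closure:
  fixes S :: "'h::complex_hilbert set"
  assumes "csubspace S"
  shows "csubspace (closure S)"
proof (rule complex_vector.subspaceI)
  show "0 \<in> closure S"
    using complex_vector.subspace_0[OF assms] closure_subset by blast
next
  fix x y assume "x \<in> closure S" and "y \<in> closure S"
  then obtain a b where "\<forall>n. a n \<in> S" "a \<longlonglongrightarrow> x" "\<forall>n. b n \<in> S" "b \<longlonglongrightarrow> y"
    by (auto simp: closure_sequential)
  then show "x + y \<in> closure S"
    unfolding closure_sequential
    by (intro exI[of _ "\<lambda>n. a n + b n"])
      (auto intro: tendsto_add complex_vector.subspace_add[OF assms])
next
  fix c x assume "x \<in> closure S"
  then obtain a where "\<forall>n. a n \<in> S" "a \<longlonglongrightarrow> x"
    by (auto simp: closure_sequential)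
  then show "c *\<^sub>C x \<in> closure S"
    unfolding closure_sequential
    by (intro exI[of _ "\<lambda>n. c *\<^sub>C a n"])
      (auto intro: bounded_bilinear.tendsto[OF bounded_bilinear_scaleC] tendsto_const
        complex_vector.subspace_scale[OF assms])
qed

lemma finite_cspan_projection:
  fixes x :: "'h::complex_hilbert"
  assumes "finite B"
  shows "\<exists>p\<in>cspan B. \<forall>b\<in>B. cinner (x - p) b = 0"
  using assms
proof (induction B arbitrary: x)
  case empty
  then show ?case by (intro bexI[of _ 0]) (auto intro: complex_vector.span_zero)
next
  case (insert b B)
  from insert.IH obtain p where p: "p \<in> cspan B" "\<And>v. v \<in> B \<Longrightarrow> cinner (x - p) v = 0"
    by blast
  from insert.IH obtain r where r: "r \<in> cspan B" "\<And>v. v \<in> B \<Longrightarrow> cinner (b - r) v = 0"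
    by blast
  \<comment> \<open>One Gram--Schmidt step; if \<open>b\<close> lies in the span of \<open>B\<close>, then \<open>q = 0\<close> and \<open>c = 0\<close>.\<close>
  define q where "q = b - r"
  define c where "c = cinner (x - p) q / cinner q q"
  have sub: "cspan B \<subseteq> cspan (insert b B)"
    by (intro complex_vector.span_mono) auto
  have "q \<in> cspan (insert b B)"
    unfolding q_def using r(1) sub
    by (intro complex_vector.span_diff) (auto intro: complex_vector.span_base)
  then have mem: "p + c *\<^sub>C q \<in> cspan (insert b B)"
    using p(1) sub by (intro complex_vector.span_add complex_vector.span_scale) auto
  have orthB: "cinner (x - (p + c *\<^sub>C q)) v = 0" if "v \<in> B" for v
    using p(2)[OF that] r(2)[OF that]
    by (simp add: q_def cinner_diff_left cinner_add_left cinner_scaleC_left)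
  have "cinner (x - p) q = c * cinner q q"
    unfolding c_def using cinner_eq_zero_iff[of q] by (cases "q = 0") auto
  then have "cinner (x - (p + c *\<^sub>C q)) q = 0"
    by (simp add: cinner_diff_left cinner_add_left cinner_scaleC_left algebra_simps)
  moreover have "cinner (x - (p + c *\<^sub>C q)) r = 0"
    using orthB r(1) by (rule orthogonal_cspan)
  ultimately have "cinner (x - (p + c *\<^sub>C q)) b = 0"
    by (simp add: q_def cinner_diff_right)
  with orthB mem show ?case by blast
qed

text \<open>
  The residual of a point of the closure lies in the closure and is orthogonal to it, so it
  vanishes.
\<close>

lemma closure_cspan_finite:
  fixes B :: "'h::complex_hilbert set"
  assumes "finite B"
  shows "closure (cspan B) = cspan B"
proof
  show "closure (cspan B) \<subseteq> cspan B"
  proof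
    fix x assume x: "x \<in> closure (cspan B)"
    obtain p where p: "p \<in> cspan B" "\<And>b. b \<in> B \<Longrightarrow> cinner (x - p) b = 0"
      using finite_cspan_projection[OF assms] by blast
    have "x - p \<in> closure (cspan B)"
      using x p(1) closure_subset
      by (intro complex_vector.subspace_diff csubspace_closure complex_vector.subspace_span) auto
    then have "cinner (x - p) (x - p) = 0"
      by (rule orthogonal_closure[rotated]) (rule orthogonal_cspan[OF p(2)])
    then show "x \<in> cspan B" using p(1) by (simp add: cinner_eq_zero_iff)
  qed
qed (rule closure_subset)

section \<open>The rank of the mixed Gramian\<close>

text \<open>
  If a vector \<open>v\<close> of the span is killed, extend \<open>v\<close> to a basis; the images of the other basis
  vectors already span the image.
\<close>

lemma cdim_image_eq_iff:
  fixes L :: "'a::complex_vector \<Rightarrow> 'b::complex_vector"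
  assumes "Vector_Spaces.linear scaleC scaleC L" and "finite B"
  shows "cdim (L ` cspan B) = cdim (cspan B) \<longleftrightarrow> (\<forall>v\<in>cspan B. L v = 0 \<longrightarrow> v = 0)"
proof -
  interpret L: Vector_Spaces.linear scaleC scaleC L by fact
  show ?thesis
  proof
    assume eq: "cdim (L ` cspan B) = cdim (cspan B)"
    show "\<forall>v\<in>cspan B. L v = 0 \<longrightarrow> v = 0"
    proof (intro ballI impI, rule ccontr)
      fix v assume v: "v \<in> cspan B" "L v = 0" "v \<noteq> 0"
      obtain C where C: "{v} \<subseteq> C" "C \<subseteq> cspan B" "complex_vector.independent C"
          "cspan B \<subseteq> cspan C"
        using complex_vector.maximal_independent_subset_extend[of "{v}" "cspan B"] v
        by (auto simp: complex_vector.dependent_single)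
      have fin: "finite C"
        using complex_vector.independent_span_bound[OF assms(2) C(3)] C(2) by blast
      have dim: "cdim (cspan B) = card C"
        by (rule complex_vector.basis_card_eq_dim[symmetric]) (use C in auto)
      have "L ` cspan B \<subseteq> cspan (L ` C)"
        using C(4) by (auto simp: L.span_image)
      also have "L ` C \<subseteq> insert 0 (L ` (C - {v}))" using v(2) by auto
      then have "cspan (L ` C) \<subseteq> cspan (insert 0 (L ` (C - {v})))"
        by (rule complex_vector.span_mono)
      also have "\<dots> = cspan (L ` (C - {v}))" by (rule complex_vector.span_insert_0)
      finally have "cdim (L ` cspan B) \<le> card (L ` (C - {v}))"
        by (rule complex_vector.dim_le_card) (use fin in auto)
      also have "\<dots> \<le> card (C - {v})" using fin by (intro card_image_le) auto
      also have "\<dots> < card C" using fin C(1) by (intro psubset_card_mono) auto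
      finally show False using eq dim by simp
    qed
  next
    assume ker: "\<forall>v\<in>cspan B. L v = 0 \<longrightarrow> v = 0"
    obtain C where C: "C \<subseteq> cspan B" "complex_vector.independent C" "cspan B \<subseteq> cspan C"
      using complex_vector.maximal_independent_subset by blast
    have span: "cspan C = cspan B"
      using C complex_vector.span_minimal[OF C(1) complex_vector.subspace_span] by blast
    have inj: "inj_on L (cspan C)"
    proof (rule inj_onI)
      fix x y assume "x \<in> cspan C" "y \<in> cspan C" "L x = L y"
      then have "x - y = 0"
        using ker span by (metis L.diff complex_vector.span_diff diff_self)
      then show "x = y" by simp
    qed
    have "complex_vector.independent (L ` C)"
      using L.independent_inj_on_image[OF C(2) inj] .
    moreover have "cspan (L ` C) = cspan (L ` cspan B)"
      by (simp add: L.span_image span complex_vector.span_span)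
    ultimately have "cdim (L ` cspan B) = card (L ` C)"
      by (intro complex_vector.dim_eq_card)
    also have "\<dots> = card C"
      by (intro card_image inj_on_subset[OF inj] complex_vector.span_superset)
    also have "\<dots> = cdim (cspan B)"
      by (rule complex_vector.basis_card_eq_dim) (use C in auto)
    finally show "cdim (L ` cspan B) = cdim (cspan B)" .
  qed
qed

lemma range_linear_combinations:
  fixes v :: "nat \<Rightarrow> 'a::complex_vector"
  shows "range (\<lambda>c. \<Sum>j<r. c j *\<^sub>C v j) = cspan (v ` {..<r})"
proof
  show "range (\<lambda>c. \<Sum>j<r. c j *\<^sub>C v j) \<subseteq> cspan (v ` {..<r})"
    by (auto intro!: complex_vector.span_sum complex_vector.span_scale
        intro: complex_vector.span_base)
next
  have "csubspace (range (\<lambda>c. \<Sum>j<r. c j *\<^sub>C v j))"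
  proof (rule complex_vector.subspaceI)
    show "0 \<in> range (\<lambda>c. \<Sum>j<r. c j *\<^sub>C v j)" by (intro range_eqI[of _ _ "\<lambda>_. 0"]) simp
  next
    fix x y assume "x \<in> range (\<lambda>c. \<Sum>j<r. c j *\<^sub>C v j)" "y \<in> range (\<lambda>c. \<Sum>j<r. c j *\<^sub>C v j)"
    then obtain c d where "x = (\<Sum>j<r. c j *\<^sub>C v j)" "y = (\<Sum>j<r. d j *\<^sub>C v j)" by auto
    then show "x + y \<in> range (\<lambda>c. \<Sum>j<r. c j *\<^sub>C v j)"
      by (intro range_eqI[of _ _ "\<lambda>j. c j + d j"]) (simp add: scaleC_add_left sum.distrib)
  next
    fix a x assume "x \<in> range (\<lambda>c. \<Sum>j<r. c j *\<^sub>C v j)"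
    then obtain c where "x = (\<Sum>j<r. c j *\<^sub>C v j)" by auto
    then show "a *\<^sub>C x \<in> range (\<lambda>c. \<Sum>j<r. c j *\<^sub>C v j)"
      by (intro range_eqI[of _ _ "\<lambda>j. a * c j"])
        (simp add: scaleC_scaleC complex_vector.scale_sum_right)
  qed
  moreover have "v ` {..<r} \<subseteq> range (\<lambda>c. \<Sum>j<r. c j *\<^sub>C v j)"
  proof
    fix y assume "y \<in> v ` {..<r}"
    then obtain k where k: "k < r" "y = v k" by auto
    have "(\<Sum>j<r. (if j = k then 1 else 0) *\<^sub>C v j) = (\<Sum>j<r. if j = k then v j else 0)"
      by (intro sum.cong) (auto simp: scaleC_one)
    also have "\<dots> = y" using k by simp
    finally show "y \<in> range (\<lambda>c. \<Sum>j<r. c j *\<^sub>C v j)"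
      by (intro range_eqI[of _ _ "\<lambda>j. if j = k then 1 else 0"]) simp
  qed
  ultimately show "cspan (v ` {..<r}) \<subseteq> range (\<lambda>c. \<Sum>j<r. c j *\<^sub>C v j)"
    by (rule complex_vector.span_minimal[rotated])
qed

text \<open>
  The range of the mixed Gramian at \<open>x\<close> is the image of the fibre space under the analysis map
  \<open>v \<mapsto> (\<langle>v, \<psi>\<^sub>i(x)\<rangle>)\<^sub>i\<close>, whatever linear dependencies there are among the generators.  So the
  ranks agree exactly if this map is injective on the fibre space.
\<close>

lemma cdim_range_mixed_gramian_iff:
  fixes \<phi>s :: "('x \<Rightarrow> 'h::complex_hilbert) list"
  shows "cdim (range (mixed_gramian \<phi>s I \<psi> x)) = cdim (fibre_space (set \<phi>s) x) \<longleftrightarrow>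
    (\<forall>v\<in>fibre_space (set \<phi>s) x. (\<forall>i\<in>I. cinner v (\<psi> i x) = 0) \<longrightarrow> v = 0)"
proof -
  define v where "v j = (\<phi>s ! j) x" for j
  define L where "L u = (\<lambda>i. if i \<in> I then cinner u (\<psi> i x) else 0)" for u
  have set_eq: "(\<lambda>\<phi>. \<phi> x) ` set \<phi>s = v ` {..<length \<phi>s}"
    by (force simp: v_def set_conv_nth)
  have fibre: "fibre_space (set \<phi>s) x = cspan (v ` {..<length \<phi>s})"
    unfolding fibre_space_def set_eq by (rule closure_cspan_finite) simp
  have lin: "Vector_Spaces.linear scaleC scaleC L"
    by unfold_locales
      (auto simp: L_def fun_eq_iff cinner_add_left cinner_scaleC_left scaleC_fun_def
        scaleC_complex_def)
  interpret L: Vector_Spaces.linear scaleC scaleC L by (rule lin)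
  have "mixed_gramian \<phi>s I \<psi> x c = L (\<Sum>j<length \<phi>s. c j *\<^sub>C v j)" for c
  proof -
    have "L (\<Sum>j<length \<phi>s. c j *\<^sub>C v j) = (\<Sum>j<length \<phi>s. c j *\<^sub>C L (v j))"
      by (simp add: L.sum L.scale)
    also have "\<dots> = mixed_gramian \<phi>s I \<psi> x c"
    proof
      fix i
      have "(\<Sum>j<n. c j *\<^sub>C L (v j)) i = (\<Sum>j<n. (c j *\<^sub>C L (v j)) i)" for n
        by (induction n) simp_all
      then show "(\<Sum>j<length \<phi>s. c j *\<^sub>C L (v j)) i = mixed_gramian \<phi>s I \<psi> x c i"
        by (simp add: mixed_gramian_def scaleC_fun_def scaleC_complex_def L_def v_def mult.commute)
    qed
    finally show ?thesis by simp
  qed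
  then have "range (mixed_gramian \<phi>s I \<psi> x) = L ` range (\<lambda>c. \<Sum>j<length \<phi>s. c j *\<^sub>C v j)"
    by (auto simp: image_def)
  then have range: "range (mixed_gramian \<phi>s I \<psi> x) = L ` cspan (v ` {..<length \<phi>s})"
    by (simp only: range_linear_combinations)
  have "L u = 0 \<longleftrightarrow> (\<forall>i\<in>I. cinner u (\<psi> i x) = 0)" for u
    by (auto simp: L_def fun_eq_iff)
  then show ?thesis
    unfolding range fibre using cdim_image_eq_iff[OF lin, of "v ` {..<length \<phi>s}"] by simp
qed

section \<open>Square-integrable vector-valued functions\<close>

lemma L2_measurable: "f \<in> L2 M \<Longrightarrow> f \<in> borel_measurable M"
  by (simp add: L2_def)

lemma L2_integrable_sq: "f \<in> L2 M \<Longrightarrow> integrable M (\<lambda>x. (norm (f x))\<^sup>2)"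
  by (simp add: L2_def)

lemma integrable_cinner:
  assumes "f \<in> L2 M" and "h \<in> L2 M"
  shows "integrable M (\<lambda>x. cinner (f x) (h x))"
proof (rule Bochner_Integration.integrable_bound)
  show "integrable M (\<lambda>x. (norm (f x))\<^sup>2 + (norm (h x))\<^sup>2)"
    using assms by (intro Bochner_Integration.integrable_add L2_integrable_sq)
  show "(\<lambda>x. cinner (f x) (h x)) \<in> borel_measurable M"
    using assms by (intro borel_measurable_cinner L2_measurable)
  have "norm (cinner (f x) (h x)) \<le> (norm (f x))\<^sup>2 + (norm (h x))\<^sup>2" for x
  proof -
    have "0 \<le> (norm (f x) - norm (h x))\<^sup>2" and "0 \<le> (norm (f x))\<^sup>2 + (norm (h x))\<^sup>2" by simp_all
    then have "norm (f x) * norm (h x) \<le> (norm (f x))\<^sup>2 + (norm (h x))\<^sup>2"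
      unfolding power2_diff by linarith
    then show ?thesis using norm_cinner_le order_trans by blast
  qed
  then show "AE x in M. norm (cinner (f x) (h x)) \<le> norm ((norm (f x))\<^sup>2 + (norm (h x))\<^sup>2)"
    by simp
qed

lemma norm_add_sq_le: "(norm (x + y))\<^sup>2 \<le> 2 * (norm x)\<^sup>2 + 2 * (norm (y::'a::real_normed_vector))\<^sup>2"
proof -
  have "(norm (x + y))\<^sup>2 \<le> (norm x + norm y)\<^sup>2"
    by (intro power_mono norm_triangle_ineq) simp
  also have "\<dots> \<le> 2 * (norm x)\<^sup>2 + 2 * (norm y)\<^sup>2"
    using zero_le_power2[of "norm x - norm y"] by (simp add: power2_diff power2_sum)
  finally show ?thesis .
qed

lemma L2_zero: "0 \<in> L2 M"
  by (simp add: L2_def zero_fun_def)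

lemma L2_add:
  assumes "f \<in> L2 M" and "h \<in> L2 M"
  shows "f + h \<in> L2 M"
proof -
  have [measurable]: "f \<in> borel_measurable M" "h \<in> borel_measurable M"
    using assms by (simp_all add: L2_measurable)
  have "integrable M (\<lambda>x. (norm (f x + h x))\<^sup>2)"
  proof (rule Bochner_Integration.integrable_bound)
    show "integrable M (\<lambda>x. 2 * (norm (f x))\<^sup>2 + 2 * (norm (h x))\<^sup>2)"
      using assms
      by (intro Bochner_Integration.integrable_add integrable_mult_right L2_integrable_sq)
  qed (simp_all add: norm_add_sq_le)
  then show ?thesis by (simp add: L2_def plus_fun_def)
qed

lemma L2_scaleC:
  assumes "f \<in> L2 M"
  shows "c *\<^sub>C f \<in> L2 M"
proof -
  have [measurable]: "f \<in> borel_measurable M" using assms by (rule L2_measurable)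
  show ?thesis
    using L2_integrable_sq[OF assms]
    by (simp add: L2_def scaleC_fun_def norm_scaleC power_mult_distrib)
qed

lemma csubspace_L2: "csubspace (L2 M)"
  by (rule complex_vector.subspaceI) (simp_all add: L2_zero L2_add L2_scaleC)

lemmas L2_diff = complex_vector.subspace_diff[OF csubspace_L2]

text \<open>
  The squared norm is the integral itself; for it, expansion, the parallelogram law and the
  Cauchy--Schwarz inequality replace the triangle inequality of the \<open>L\<^sup>2\<close> norm.
\<close>

definition L2_norm_sq :: "'x measure \<Rightarrow> ('x \<Rightarrow> 'h::real_normed_vector) \<Rightarrow> real"
  where "L2_norm_sq M f = (LINT x|M. (norm (f x))\<^sup>2)"

lemma L2_norm_sq_nonneg [simp]: "L2_norm_sq M f \<ge> 0"
  by (simp add: L2_norm_sq_def)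

lemma L2_norm_less_iff: "\<epsilon> > 0 \<Longrightarrow> L2_norm M f < \<epsilon> \<longleftrightarrow> L2_norm_sq M f < \<epsilon>\<^sup>2"
  unfolding L2_norm_def L2_norm_sq_def
  by (metis abs_of_pos real_sqrt_abs real_sqrt_less_iff)

lemma nn_integral_norm_sq:
  assumes "f \<in> L2 M"
  shows "(\<integral>\<^sup>+ x. ennreal ((norm (f x))\<^sup>2) \<partial>M) = ennreal (L2_norm_sq M f)"
  unfolding L2_norm_sq_def
  by (rule nn_integral_eq_integral) (simp_all add: L2_integrable_sq[OF assms])

lemma L2_inner_diff_left:
  "f \<in> L2 M \<Longrightarrow> h \<in> L2 M \<Longrightarrow> k \<in> L2 M \<Longrightarrow> L2_inner M (f - h) k = L2_inner M f k - L2_inner M h k"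
  by (simp add: L2_inner_def cinner_diff_left integrable_cinner)

lemma L2_norm_sq_diff_scaleC:
  assumes "f \<in> L2 M" and "h \<in> L2 M"
  shows "L2_norm_sq M (f - c *\<^sub>C h) =
    L2_norm_sq M f - 2 * Re (cnj c * L2_inner M f h) + (norm c)\<^sup>2 * L2_norm_sq M h"
proof -
  have int: "integrable M (\<lambda>x. cnj c * cinner (f x) (h x))"
    using integrable_cinner[OF assms] by simp
  define r where "r x = Re (cnj c * cinner (f x) (h x))" for x
  have r_int: "integrable M r" unfolding r_def using int by (rule integrable_Re)
  have r_eq: "Re (cnj c * L2_inner M f h) = (LINT x|M. r x)"
    using integral_Re[OF int] by (simp add: L2_inner_def r_def)
  have "L2_norm_sq M (f - c *\<^sub>C h) =
      (LINT x|M. (norm (f x))\<^sup>2 - 2 * r x + (norm c)\<^sup>2 * (norm (h x))\<^sup>2)"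
    by (simp only: L2_norm_sq_def scaleC_fun_def minus_apply norm_diff_scaleC_sq r_def)
  also have "\<dots> = L2_norm_sq M f - 2 * (LINT x|M. r x) + (norm c)\<^sup>2 * L2_norm_sq M h"
    using assms r_int by (simp add: L2_norm_sq_def L2_integrable_sq)
  finally show ?thesis by (simp only: r_eq)
qed

lemma L2_parallelogram:
  assumes "f \<in> L2 M" and "h \<in> L2 M"
  shows "L2_norm_sq M (f - h) + L2_norm_sq M (f + h) = 2 * L2_norm_sq M f + 2 * L2_norm_sq M h"
proof -
  have "f - 1 *\<^sub>C h = f - h" "f - (-1) *\<^sub>C h = f + h"
    by (simp_all add: scaleC_one scaleC_minus1)
  then show ?thesis
    using L2_norm_sq_diff_scaleC[OF assms, of 1] L2_norm_sq_diff_scaleC[OF assms, of "-1"]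
    by simp
qed

text \<open>It suffices to test the coefficients \<open>c = t\<langle>f, w\<rangle>\<close>, whose phase decreases the norm fastest.\<close>

lemma L2_inner_near_minimizer:
  assumes "f \<in> L2 M" and "w \<in> L2 M"
    and "\<And>c. L2_norm_sq M f - d \<le> L2_norm_sq M (f - c *\<^sub>C w)"
  shows "(norm (L2_inner M f w))\<^sup>2 \<le> d * L2_norm_sq M w"
proof (rule quadratic_bound)
  fix t :: real
  let ?c = "complex_of_real t * L2_inner M f w"
  have "Re (cnj ?c * L2_inner M f w) = t * (norm (L2_inner M f w))\<^sup>2"
    by (simp add: cmod_power2) (simp add: power2_eq_square algebra_simps)
  moreover have "(norm ?c)\<^sup>2 = t\<^sup>2 * (norm (L2_inner M f w))\<^sup>2"
    by (simp add: norm_mult power_mult_distrib)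
  ultimately show "2 * t * (norm (L2_inner M f w))\<^sup>2
      - t\<^sup>2 * (norm (L2_inner M f w))\<^sup>2 * L2_norm_sq M w \<le> d"
    using L2_norm_sq_diff_scaleC[OF assms(1,2), of ?c] assms(3)[of ?c] by (simp add: algebra_simps)
qed auto

lemma L2_Cauchy_Schwarz:
  assumes "f \<in> L2 M" and "w \<in> L2 M"
  shows "(norm (L2_inner M f w))\<^sup>2 \<le> L2_norm_sq M f * L2_norm_sq M w"
  by (rule L2_inner_near_minimizer[OF assms]) simp

section \<open>Completeness and orthogonal projection\<close>

text \<open>
  The series of the \<open>4\<^sup>n \<parallel>f\<^sub>n\<parallel>\<^sup>2\<close> converges, hence for almost every \<open>x\<close> so does the series
  of the \<open>4\<^sup>n \<parallel>f\<^sub>n(x)\<parallel>\<^sup>2\<close>, whose terms are then bounded.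
\<close>

lemma AE_norm_sq_bounded:
  fixes f :: "nat \<Rightarrow> 'x \<Rightarrow> 'h::{complex_hilbert, second_countable_topology}"
  assumes f: "\<And>n. f n \<in> L2 M" and le: "\<And>n. L2_norm_sq M (f n) \<le> C * (1/8) ^ n"
  shows "AE x in M. \<exists>K. \<forall>n. (norm (f n x))\<^sup>2 \<le> K * (1/4) ^ n"
proof -
  have [measurable]: "f n \<in> borel_measurable M" for n using f by (rule L2_measurable)
  have C: "C \<ge> 0" using order_trans[OF L2_norm_sq_nonneg le[of 0]] by simp
  have each: "(\<integral>\<^sup>+ x. ennreal (4 ^ n * (norm (f n x))\<^sup>2) \<partial>M) \<le> ennreal (C * (1/2) ^ n)" for n
  proof -
    have "(\<integral>\<^sup>+ x. ennreal (4 ^ n * (norm (f n x))\<^sup>2) \<partial>M)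
        = ennreal (4 ^ n) * (\<integral>\<^sup>+ x. ennreal ((norm (f n x))\<^sup>2) \<partial>M)"
      by (subst nn_integral_cmult[symmetric]) (simp_all add: ennreal_mult)
    also have "\<dots> = ennreal (4 ^ n * L2_norm_sq M (f n))"
      by (simp add: nn_integral_norm_sq[OF f] ennreal_mult)
    also have "\<dots> \<le> ennreal (C * (1/2) ^ n)"
    proof (rule ennreal_leI)
      have "4 ^ n * L2_norm_sq M (f n) \<le> 4 ^ n * (C * (1/8) ^ n)"
        using le by (intro mult_left_mono) auto
      also have "\<dots> = C * ((4 * (1/8)) ^ n)" by (simp only: power_mult_distrib) simp
      finally show "4 ^ n * L2_norm_sq M (f n) \<le> C * (1/2) ^ n" by simp
    qed
    finally show ?thesis .
  qed
  define S where "S x = (\<Sum>n. ennreal (4 ^ n * (norm (f n x))\<^sup>2))" for x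
  have S_meas: "S \<in> borel_measurable M" unfolding S_def by measurable
  have "(\<integral>\<^sup>+ x. S x \<partial>M) = (\<Sum>n. \<integral>\<^sup>+ x. ennreal (4 ^ n * (norm (f n x))\<^sup>2) \<partial>M)"
    unfolding S_def by (rule nn_integral_suminf) simp
  also have "\<dots> \<le> (\<Sum>n. ennreal (C * (1/2) ^ n))"
    by (intro suminf_le summableI each)
  also have "\<dots> = ennreal (\<Sum>n. C * (1/2) ^ n)"
    using C by (intro suminf_ennreal2 summable_mult summable_geometric) auto
  also have "\<dots> < \<infinity>" by simp
  finally have finite: "(\<integral>\<^sup>+ x. S x \<partial>M) < \<infinity>" .
  have "AE x in M. S x \<noteq> \<infinity>"
    by (rule nn_integral_PInf_AE[OF S_meas less_imp_neq[OF finite]])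
  then show ?thesis
  proof (eventually_elim)
    case (elim x)
    then obtain K where K: "K \<ge> 0" "S x = ennreal K" by (cases "S x") auto
    have "(norm (f n x))\<^sup>2 \<le> K * (1/4) ^ n" for n
    proof -
      have "(\<Sum>k\<in>{n}. ennreal (4 ^ k * (norm (f k x))\<^sup>2)) \<le> S x"
        unfolding S_def by (rule sum_le_suminf) (simp_all add: summableI)
      then have "ennreal (4 ^ n * (norm (f n x))\<^sup>2) \<le> ennreal K" using K by simp
      then have "4 ^ n * (norm (f n x))\<^sup>2 \<le> K" using K by simp
      then show ?thesis by (simp add: field_simps power_divide)
    qed
    then show ?case by blast
  qed
qed

lemma AE_tendsto_of_L2:
  fixes f :: "'x \<Rightarrow> 'h::{complex_hilbert, second_countable_topology}"
  assumes "f \<in> L2 M" and "\<And>n. h n \<in> L2 M"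
    and "\<And>n. L2_norm_sq M (f - h n) \<le> C * (1/8) ^ n"
  shows "AE x in M. (\<lambda>n. h n x) \<longlonglongrightarrow> f x"
proof -
  have "AE x in M. \<exists>K. \<forall>n. (norm ((f - h n) x))\<^sup>2 \<le> K * (1/4) ^ n"
    by (rule AE_norm_sq_bounded[OF L2_diff[OF assms(1,2)] assms(3)])
  then show ?thesis
  proof (eventually_elim)
    case (elim x)
    then obtain K where K: "\<And>n. (norm (h n x - f x))\<^sup>2 \<le> K * (1/4) ^ n"
      by (auto simp: norm_minus_commute)
    have "(\<lambda>n. K * (1/4) ^ n) \<longlonglongrightarrow> 0"
      by (intro tendsto_mult_right_zero LIMSEQ_power_zero) auto
    then have "(\<lambda>n. (norm (h n x - f x))\<^sup>2) \<longlonglongrightarrow> 0"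
      by (rule tendsto_sandwich[OF _ _ tendsto_const, rotated 2]) (use K in auto)
    then have "(\<lambda>n. sqrt ((norm (h n x - f x))\<^sup>2)) \<longlonglongrightarrow> sqrt 0"
      by (rule tendsto_real_sqrt)
    then show ?case by (simp add: LIM_zero_iff tendsto_norm_zero_iff)
  qed
qed

text \<open>
  The completeness of \<open>L\<^sup>2\<close>, for sequences that converge fast.  The rate \<open>8\<^sup>-\<^sup>n\<close> for the squared
  norms makes almost every sequence of values Cauchy with the rate \<open>2\<^sup>-\<^sup>n\<close>, and Fatou's lemma
  turns the pointwise limit into an \<open>L\<^sup>2\<close> limit.
\<close>

lemma L2_complete:
  fixes h :: "nat \<Rightarrow> 'x \<Rightarrow> 'h::{complex_hilbert, second_countable_topology}"
  assumes h: "\<And>n. h n \<in> L2 M"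
    and le: "\<And>m n. n \<le> m \<Longrightarrow> L2_norm_sq M (h m - h n) \<le> C * (1/8) ^ n"
  obtains p where "p \<in> L2 M" and "\<And>n. L2_norm_sq M (p - h n) \<le> C * (1/8) ^ n"
proof -
  define p where "p x = lim (\<lambda>n. h n x)" for x
  have [measurable]: "h n \<in> borel_measurable M" for n using h by (rule L2_measurable)
  have p_meas [measurable]: "p \<in> borel_measurable M" unfolding p_def by simp
  have C: "C \<ge> 0" using order_trans[OF L2_norm_sq_nonneg le[of 0 0]] by simp
  have "AE x in M. \<exists>K. \<forall>n. (norm ((h (Suc n) - h n) x))\<^sup>2 \<le> K * (1/4) ^ n"
    by (rule AE_norm_sq_bounded[where f = "\<lambda>n. h (Suc n) - h n" and C = C])
      (simp_all only: L2_diff h le le_SucI le_refl)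
  then have conv: "AE x in M. (\<lambda>n. h n x) \<longlonglongrightarrow> p x"
  proof (eventually_elim)
    case (elim x)
    then obtain K where K: "\<And>n. (norm (h (Suc n) x - h n x))\<^sup>2 \<le> K * (1/4) ^ n" by auto
    have "K \<ge> 0" using K[of 0] by (metis mult.right_neutral order_trans power_0 zero_le_power2)
    have le_geometric: "norm (h (Suc n) x - h n x) \<le> sqrt K * (1/2) ^ n" for n
    proof (rule power2_le_imp_le)
      have "(1/4 :: real) ^ n = ((1/2) ^ n)\<^sup>2"
        by (simp add: power2_eq_square flip: power_mult_distrib)
      then show "(norm (h (Suc n) x - h n x))\<^sup>2 \<le> (sqrt K * (1/2) ^ n)\<^sup>2"
        using K[of n] \<open>K \<ge> 0\<close> by (simp add: power_mult_distrib)
    qed (use \<open>K \<ge> 0\<close> in simp)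
    have "summable (\<lambda>n. sqrt K * (1/2) ^ n)"
      by (intro summable_mult summable_geometric) simp
    then have "summable (\<lambda>n. h (Suc n) x - h n x)"
      by (rule summable_comparison_test'[where N = 0]) (rule le_geometric)
    then have "convergent (\<lambda>n. \<Sum>k<n. h (Suc k) x - h k x)"
      by (simp only: summable_iff_convergent)
    then have "convergent (\<lambda>n. h n x - h 0 x)"
      by (simp only: sum_lessThan_telescope[of "\<lambda>n. h n x"])
    then have "convergent (\<lambda>n. (h n x - h 0 x) + h 0 x)"
      by (intro convergent_add convergent_const)
    then show ?case by (simp add: p_def convergent_LIMSEQ_iff)
  qed
  have bound: "(\<integral>\<^sup>+ x. ennreal ((norm (p x - h n x))\<^sup>2) \<partial>M) \<le> ennreal (C * (1/8) ^ n)" for n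
  proof -
    have "(\<integral>\<^sup>+ x. ennreal ((norm (p x - h n x))\<^sup>2) \<partial>M)
        = (\<integral>\<^sup>+ x. liminf (\<lambda>m. ennreal ((norm (h m x - h n x))\<^sup>2)) \<partial>M)"
    proof (rule nn_integral_cong_AE, use conv in eventually_elim)
      case (elim x)
      then have "(\<lambda>m. ennreal ((norm (h m x - h n x))\<^sup>2)) \<longlonglongrightarrow> ennreal ((norm (p x - h n x))\<^sup>2)"
        by (intro tendsto_intros)
      then show ?case by (rule lim_imp_Liminf[OF sequentially_bot, symmetric])
    qed
    also have "\<dots> \<le> liminf (\<lambda>m. \<integral>\<^sup>+ x. ennreal ((norm (h m x - h n x))\<^sup>2) \<partial>M)"
      by (rule nn_integral_liminf) simp
    also have "\<dots> \<le> ennreal (C * (1/8) ^ n)"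
    proof (rule order_trans[OF Liminf_le_Limsup], simp, rule Limsup_bounded)
      show "\<forall>\<^sub>F m in sequentially. (\<integral>\<^sup>+ x. ennreal ((norm (h m x - h n x))\<^sup>2) \<partial>M)
          \<le> ennreal (C * (1/8) ^ n)"
        using eventually_ge_at_top[of n]
      proof eventually_elim
        case (elim m)
        have "h m - h n \<in> L2 M" using h by (intro L2_diff) auto
        from nn_integral_norm_sq[OF this] le[OF elim] show ?case by (simp add: ennreal_leI)
      qed
    qed
    finally show ?thesis .
  qed
  have diff: "p - h n \<in> L2 M" for n
  proof -
    have "integrable M (\<lambda>x. (norm (p x - h n x))\<^sup>2)"
      by (rule integrableI_bounded) (use bound[of n] in \<open>simp_all add: le_less_trans\<close>)
    then show ?thesis by (simp add: L2_def fun_diff_def)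
  qed
  show ?thesis
  proof
    have "(p - h 0) + h 0 \<in> L2 M" using diff h by (rule L2_add)
    then show "p \<in> L2 M" by simp
    show "L2_norm_sq M (p - h n) \<le> C * (1/8) ^ n" for n
      using bound[of n] nn_integral_norm_sq[OF diff[of n]] C by simp
  qed
qed

text \<open>
  Near minimizers of the distance to \<open>u\<close> form a Cauchy sequence by the parallelogram law, and
  they are nearly orthogonal to \<open>W\<close>; the limit is the projection.
\<close>

lemma L2_projection_exists:
  fixes W :: "('x \<Rightarrow> 'h::{complex_hilbert, second_countable_topology}) set"
  assumes sub: "csubspace W" and W: "W \<subseteq> L2 M" and u: "u \<in> L2 M"
  obtains p where "p \<in> L2_closure M W" and "\<And>w. w \<in> W \<Longrightarrow> L2_inner M (u - p) w = 0"
proof -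
  define d where "d = (INF w\<in>W. L2_norm_sq M (u - w))"
  have bdd: "bdd_below ((\<lambda>w. L2_norm_sq M (u - w)) ` W)"
    by (intro bdd_belowI2[of _ 0]) simp
  have ne: "W \<noteq> {}" using complex_vector.subspace_0[OF sub] by auto
  have d_le: "d \<le> L2_norm_sq M (u - w)" if "w \<in> W" for w
    unfolding d_def using bdd that by (rule cINF_lower)
  have "\<exists>w\<in>W. L2_norm_sq M (u - w) < d + (1/8) ^ n" for n
    using cINF_less_iff[OF ne bdd, of "d + (1/8) ^ n"] by (simp add: d_def)
  then obtain h where h: "\<And>n. h n \<in> W" "\<And>n. L2_norm_sq M (u - h n) < d + (1/8) ^ n"
    by metis
  have hL2: "h n \<in> L2 M" and uh: "u - h n \<in> L2 M" for n
    using h(1) W u by (auto intro: L2_diff)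
  have "L2_norm_sq M (h m - h n) \<le> 4 * (1/8) ^ n" if "n \<le> m" for m n
  proof -
    let ?mid = "(1/2) *\<^sub>C (h n + h m)"
    have "?mid \<in> W"
      using h(1) by (intro complex_vector.subspace_scale[OF sub] complex_vector.subspace_add[OF sub])
    then have "d \<le> L2_norm_sq M (u - ?mid)" by (rule d_le)
    moreover have "L2_norm_sq M ((u - h n) + (u - h m)) = 4 * L2_norm_sq M (u - ?mid)"
    proof -
      have "(u - h n) + (u - h m) = 0 - (-2) *\<^sub>C (u - ?mid)"
      proof -
        have "2 *\<^sub>C u = u + u" using complex_vector.scale_left_distrib[of 1 1 u] by (simp add: scaleC_one)
        then show ?thesis
          by (simp add: complex_vector.scale_right_diff_distrib scaleC_scaleC algebra_simps)
      qed
      moreover have "u - ?mid \<in> L2 M"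
        using u hL2 by (intro L2_diff L2_scaleC L2_add)
      ultimately show ?thesis
        using L2_norm_sq_diff_scaleC[OF L2_zero, of "u - ?mid" M "-2"]
        by (simp add: L2_inner_def L2_norm_sq_def)
    qed
    moreover have "L2_norm_sq M (h m - h n) + L2_norm_sq M ((u - h n) + (u - h m)) =
        2 * L2_norm_sq M (u - h n) + 2 * L2_norm_sq M (u - h m)"
    proof -
      have "h m - h n = (u - h n) - (u - h m)" by simp
      then show ?thesis using L2_parallelogram[OF uh[of n] uh[of m]] by (simp only:)
    qed
    moreover have "(1/8 :: real) ^ m \<le> (1/8) ^ n" using that by (intro power_decreasing) auto
    ultimately show ?thesis using h(2)[of n] h(2)[of m] by linarith
  qed
  from L2_complete[OF hL2 this] obtain p where p: "p \<in> L2 M"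
    "\<And>n. L2_norm_sq M (p - h n) \<le> 4 * (1/8) ^ n" by blast
  have lim: "(\<lambda>n. K * (1/8 :: real) ^ n) \<longlonglongrightarrow> 0" for K
    by (intro tendsto_mult_right_zero LIMSEQ_power_zero) auto
  show ?thesis
  proof
    show "p \<in> L2_closure M W"
      unfolding L2_closure_def
    proof (intro CollectI conjI allI impI p(1))
      fix \<epsilon> :: real assume "\<epsilon> > 0"
      then have "\<epsilon>\<^sup>2 > 0" by simp
      with lim[of 4] have "\<forall>\<^sub>F n in sequentially. 4 * (1/8) ^ n < \<epsilon>\<^sup>2"
        by (rule order_tendstoD)
      then obtain n where "4 * (1/8) ^ n < \<epsilon>\<^sup>2" by (auto simp: eventually_sequentially)
      then have "L2_norm M (p - h n) < \<epsilon>"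
        using p(2)[of n] \<open>\<epsilon> > 0\<close> by (simp add: L2_norm_less_iff)
      then show "\<exists>h\<in>W. L2_norm M (p - h) < \<epsilon>" using h(1) by blast
    qed
  next
    fix w assume w: "w \<in> W"
    then have wL2: "w \<in> L2 M" using W by auto
    have near: "(norm (L2_inner M (u - h n) w))\<^sup>2 \<le> (1/8) ^ n * L2_norm_sq M w" for n
    proof (rule L2_inner_near_minimizer[OF uh wL2])
      fix c
      have "h n + c *\<^sub>C w \<in> W"
        using h(1) w by (intro complex_vector.subspace_scale[OF sub] complex_vector.subspace_add[OF sub])
      from d_le[OF this] h(2)[of n]
      show "L2_norm_sq M (u - h n) - (1/8) ^ n \<le> L2_norm_sq M (u - h n - c *\<^sub>C w)"
        by (simp add: diff_diff_eq)
    qed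
    \<comment> \<open>The constant is \<open>2\<cdot>1\<close> from the near minimizer plus \<open>2\<cdot>4\<close> from the distance to the limit.\<close>
    have "(norm (L2_inner M (u - p) w))\<^sup>2 \<le> (10 * L2_norm_sq M w) * (1/8) ^ n" for n
    proof -
      have ph: "p - h n \<in> L2 M" using p(1) hL2 by (rule L2_diff)
      have "L2_inner M (u - p) w = L2_inner M ((u - h n) - (p - h n)) w" by simp
      also have "\<dots> = L2_inner M (u - h n) w - L2_inner M (p - h n) w"
        using uh ph wL2 by (rule L2_inner_diff_left)
      finally have "(norm (L2_inner M (u - p) w))\<^sup>2 \<le>
          2 * (norm (L2_inner M (u - h n) w))\<^sup>2 + 2 * (norm (L2_inner M (p - h n) w))\<^sup>2"
        using norm_add_sq_le[of "L2_inner M (u - h n) w" "- L2_inner M (p - h n) w"] by simp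
      moreover have "(norm (L2_inner M (p - h n) w))\<^sup>2 \<le> (4 * (1/8) ^ n) * L2_norm_sq M w"
        using L2_Cauchy_Schwarz[OF ph wL2] mult_right_mono[OF p(2)[of n] L2_norm_sq_nonneg[of M w]]
        by linarith
      ultimately show ?thesis using near[of n] by (simp add: algebra_simps)
    qed
    then have "(norm (L2_inner M (u - p) w))\<^sup>2 \<le> 0"
      by (intro LIMSEQ_le_const[OF lim]) auto
    then show "L2_inner M (u - p) w = 0" by simp
  qed
qed

section \<open>Multiplication-invariant spaces and their fibres\<close>

lemma parseval_determining_zero:
  assumes pars: "parseval_determining M N g" and F: "integrable M F"
    and zero: "AE s in N. (LINT x|M. F x * cnj (g s x)) = 0"
  shows "AE x in M. F x = 0"
proof -
  have [measurable]: "F \<in> borel_measurable M" using F by simp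
  have "(\<integral>\<^sup>+ x. ennreal ((norm (F x))\<^sup>2) \<partial>M) =
      (\<integral>\<^sup>+ s. ennreal ((norm (LINT x|M. F x * cnj (g s x)))\<^sup>2) \<partial>N)"
    using pars F by (simp add: parseval_determining_def)
  also have "\<dots> = (\<integral>\<^sup>+ s. 0 \<partial>N)"
    by (rule nn_integral_cong_AE, use zero in eventually_elim) simp
  finally have "(\<integral>\<^sup>+ x. ennreal ((norm (F x))\<^sup>2) \<partial>M) = 0" by simp
  then have "AE x in M. ennreal ((norm (F x))\<^sup>2) = 0"
    by (subst (asm) nn_integral_0_iff_AE) auto
  then show ?thesis by eventually_elim (simp add: ennreal_eq_0_iff)
qed

lemma mult_op_L2:
  assumes "\<phi> \<in> Linf M" and "f \<in> L2 M"
  shows "mult_op \<phi> f \<in> L2 M"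
proof -
  have [measurable]: "\<phi> \<in> borel_measurable M" "f \<in> borel_measurable M"
    using assms by (simp_all add: L2_measurable Linf_def)
  obtain C where "AE x in M. norm (\<phi> x) \<le> C" using assms(1) by (auto simp: Linf_def)
  then have bound: "AE x in M. norm ((norm (\<phi> x *\<^sub>C f x))\<^sup>2) \<le> norm (C\<^sup>2 * (norm (f x))\<^sup>2)"
  proof eventually_elim
    case (elim x)
    then show ?case
      by (simp add: norm_scaleC power_mult_distrib) (intro mult_right_mono power_mono; simp)
  qed
  have "integrable M (\<lambda>x. C\<^sup>2 * (norm (f x))\<^sup>2)"
    using L2_integrable_sq[OF assms(2)] by simp
  then have "integrable M (\<lambda>x. (norm (\<phi> x *\<^sub>C f x))\<^sup>2)"
    by (rule Bochner_Integration.integrable_bound[OF _ _ bound]) measurable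
  then show ?thesis by (simp add: L2_def mult_op_def)
qed

lemma L2_inner_mult_op:
  "L2_inner M f (mult_op \<phi> \<psi>) = (LINT x|M. cinner (f x) (\<psi> x) * cnj (\<phi> x))"
  by (simp add: L2_inner_def mult_op_def cinner_scaleC_right mult.commute)

lemma AE_orthogonal:
  assumes pars: "parseval_determining M N g" and "f \<in> L2 M" and "\<psi> \<in> L2 M"
    and "AE s in N. L2_inner M f (mult_op (g s) \<psi>) = 0"
  shows "AE x in M. cinner (f x) (\<psi> x) = 0"
  using assms
  by (intro parseval_determining_zero[OF pars] integrable_cinner) (simp_all add: L2_inner_mult_op)

lemma cspan_MI_system_subset_L2:
  assumes "parseval_determining M N g" and "B \<subseteq> L2 M"
  shows "cspan (MI_system (g ` space N) B) \<subseteq> L2 M"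
  using assms
  by (intro complex_vector.span_minimal csubspace_L2)
    (auto simp: MI_system_def parseval_determining_def intro!: mult_op_L2)

lemma MI_span_subset_L2: "MI_span M D B \<subseteq> L2 M"
  by (auto simp: MI_span_def L2_closure_def)

lemma closed_fibre_space: "closed (fibre_space B x)"
  by (simp add: fibre_space_def)

lemma csubspace_fibre_space: "csubspace (fibre_space B x)"
  unfolding fibre_space_def by (intro csubspace_closure complex_vector.subspace_span)

lemma fibre_space_base: "\<phi> \<in> B \<Longrightarrow> \<phi> x \<in> fibre_space B x"
  unfolding fibre_space_def
  by (rule subsetD[OF closure_subset], rule complex_vector.span_base) simp

lemma orthogonal_fibre_space:
  assumes "\<And>\<phi>. \<phi> \<in> B \<Longrightarrow> cinner u (\<phi> x) = 0" and "v \<in> fibre_space B x"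
  shows "cinner u v = 0"
proof (rule orthogonal_closure)
  show "v \<in> closure (cspan ((\<lambda>\<phi>. \<phi> x) ` B))"
    using assms(2) by (simp add: fibre_space_def)
  fix b assume b: "b \<in> cspan ((\<lambda>\<phi>. \<phi> x) ` B)"
  show "cinner u b = 0"
    by (rule orthogonal_cspan[OF _ b]) (auto simp: assms(1))
qed

lemma cspan_MI_system_in_fibre_space:
  assumes "f \<in> cspan (MI_system D B)"
  shows "f x \<in> fibre_space B x"
  using assms
proof (induction rule: complex_vector.span_induct_alt)
  case base
  show ?case using complex_vector.subspace_0[OF csubspace_fibre_space] by simp
next
  case (step c f h)
  from step(1) obtain \<phi> b where "f = mult_op \<phi> b" "b \<in> B" by (auto simp: MI_system_def)
  then have "f x \<in> fibre_space B x"
    by (simp add: mult_op_def complex_vector.subspace_scale[OF csubspace_fibre_space]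
        fibre_space_base)
  then show ?case
    using step(2)
    by (simp add: scaleC_fun_def complex_vector.subspace_add[OF csubspace_fibre_space]
        complex_vector.subspace_scale[OF csubspace_fibre_space])
qed

text \<open>
  Fibre spaces are closed, and an element of the MI span is almost everywhere the pointwise
  limit of a sequence of combinations of the \<open>g\<^sub>s \<phi>\<close>.
\<close>

lemma MI_span_in_fibre_space:
  assumes sub: "cspan (MI_system D B) \<subseteq> L2 M" and f: "f \<in> MI_span M D B"
  shows "AE x in M. f x \<in> fibre_space B x"
proof -
  have fL2: "f \<in> L2 M" using f MI_span_subset_L2 by blast
  have "\<exists>h\<in>cspan (MI_system D B). L2_norm_sq M (f - h) < (1/8) ^ n" for n
  proof -
    have "sqrt ((1/8) ^ n) > 0" by simp
    then obtain h where "h \<in> cspan (MI_system D B)" "L2_norm M (f - h) < sqrt ((1/8) ^ n)"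
      using f unfolding MI_span_def L2_closure_def by blast
    then show ?thesis by (intro bexI[of _ h]) (simp_all add: L2_norm_less_iff)
  qed
  then obtain h where h: "\<And>n. h n \<in> cspan (MI_system D B)"
    "\<And>n. L2_norm_sq M (f - h n) < (1/8) ^ n" by metis
  have "AE x in M. (\<lambda>n. h n x) \<longlonglongrightarrow> f x"
    by (rule AE_tendsto_of_L2[where C = 1]) (use fL2 h sub in \<open>auto intro: less_imp_le\<close>)
  then show ?thesis
  proof eventually_elim
    case (elim x)
    show ?case
      by (rule closed_sequentially[OF closed_fibre_space _ elim])
        (rule cspan_MI_system_in_fibre_space[OF h(1)])
  qed
qed

text \<open>
  The \<open>L\<^sup>2\<close> projection onto an MI span acts fibrewise: orthogonality to all \<open>g\<^sub>s \<phi>\<close> says that the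
  integrable function \<open>\<langle>\<psi> - p, \<phi>\<rangle>\<close> has vanishing coefficients against the determining set, hence
  vanishes almost everywhere.
\<close>

lemma MI_span_projection:
  fixes B :: "('x \<Rightarrow> 'h::{complex_hilbert, second_countable_topology}) set"
  assumes pars: "parseval_determining M N g" and B: "B \<subseteq> L2 M" "countable B"
    and \<psi>: "\<psi> \<in> L2 M"
  obtains p where "p \<in> MI_span M (g ` space N) B"
    and "AE x in M. \<forall>v\<in>fibre_space B x. cinner (\<psi> x - p x) v = 0"
proof -
  let ?W = "cspan (MI_system (g ` space N) B)"
  obtain p where p: "p \<in> MI_span M (g ` space N) B"
      and orth: "\<And>w. w \<in> ?W \<Longrightarrow> L2_inner M (\<psi> - p) w = 0"
    using L2_projection_exists[OF complex_vector.subspace_span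
        cspan_MI_system_subset_L2[OF pars B(1)] \<psi>]
    unfolding MI_span_def by blast
  have diff: "\<psi> - p \<in> L2 M" using \<psi> p MI_span_subset_L2 by (intro L2_diff) auto
  have "AE x in M. cinner ((\<psi> - p) x) (\<phi> x) = 0" if "\<phi> \<in> B" for \<phi>
  proof (rule AE_orthogonal[OF pars diff])
    show "\<phi> \<in> L2 M" using that B by auto
    have "mult_op (g s) \<phi> \<in> ?W" if "s \<in> space N" for s
      using that \<open>\<phi> \<in> B\<close> by (intro complex_vector.span_base) (auto simp: MI_system_def)
    then show "AE s in N. L2_inner M (\<psi> - p) (mult_op (g s) \<phi>) = 0"
      by (intro AE_I2 orth)
  qed
  then have "AE x in M. \<forall>\<phi>\<in>B. cinner ((\<psi> - p) x) (\<phi> x) = 0"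
    by (rule AE_ball_countable'[OF _ B(2)])
  then have "AE x in M. \<forall>v\<in>fibre_space B x. cinner (\<psi> x - p x) v = 0"
  proof eventually_elim
    case (elim x)
    then show ?case by (auto intro: orthogonal_fibre_space[of B _ x])
  qed
  with p show ?thesis by (rule that)
qed

text \<open>
  An MI span is determined by its fibres.  If \<open>f(x)\<close> lies in the fibre space almost everywhere,
  then so does the difference of \<open>f\<close> and its projection, which is also orthogonal to the fibre
  space.
\<close>

lemma MI_span_iff_fibre_space:
  fixes B :: "('x \<Rightarrow> 'h::{complex_hilbert, second_countable_topology}) set"
  assumes pars: "parseval_determining M N g" and B: "B \<subseteq> L2 M" "countable B"
  shows "f \<in> MI_span M (g ` space N) B \<longleftrightarrow>
    f \<in> L2 M \<and> (AE x in M. f x \<in> fibre_space B x)" (is "?L \<longleftrightarrow> ?R")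
proof
  note sub = cspan_MI_system_subset_L2[OF pars B(1)]
  {
    assume ?L
    then show ?R using MI_span_subset_L2 MI_span_in_fibre_space[OF sub] by blast
  next
    assume R: ?R
    obtain p where p: "p \<in> MI_span M (g ` space N) B"
      and orth: "AE x in M. \<forall>v\<in>fibre_space B x. cinner (f x - p x) v = 0"
      using MI_span_projection[OF pars B conjunct1[OF R]] by blast
    have "AE x in M. p x \<in> fibre_space B x" by (rule MI_span_in_fibre_space[OF sub p])
    with conjunct2[OF R] orth have eq: "AE x in M. f x = p x"
    proof eventually_elim
      case (elim x)
      then have "f x - p x \<in> fibre_space B x"
        by (intro complex_vector.subspace_diff[OF csubspace_fibre_space])
      with elim have "cinner (f x - p x) (f x - p x) = 0" by blast
      then show ?case by (simp add: cinner_eq_zero_iff)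
    qed
    have "L2_norm M (f - h) = L2_norm M (p - h)" if "h \<in> cspan (MI_system (g ` space N) B)" for h
    proof -
      have [measurable]: "f \<in> borel_measurable M" "p \<in> borel_measurable M" "h \<in> borel_measurable M"
        using R p that sub MI_span_subset_L2[of M "g ` space N" B]
        by (auto intro!: L2_measurable)
      have "(LINT x|M. (norm ((f - h) x))\<^sup>2) = (LINT x|M. (norm ((p - h) x))\<^sup>2)"
        by (rule integral_cong_AE) (use eq in auto)
      then show ?thesis by (simp add: L2_norm_def)
    qed
    then show ?L using p R by (auto simp: MI_span_def L2_closure_def)
  }
qed

section \<open>Injectivity of the sampling operator\<close>

text \<open>
  By Parseval, the squared norm of the row \<open>s \<mapsto> \<langle>f, g\<^sub>s \<psi>\<^sub>i\<rangle>\<close> is \<open>\<integral>|\<langle>f(x), \<psi>\<^sub>i(x)\<rangle>|\<^sup>2\<close>, so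
  the kernel of the sampling operator is described pointwise.
\<close>

lemma sampling_op_eq_iff:
  fixes \<psi> :: "'i \<Rightarrow> 'x \<Rightarrow> 'h::{complex_hilbert, second_countable_topology}"
  assumes pars: "parseval_determining M N g" and N: "sigma_finite_measure N"
    and I: "countable I" and \<psi>: "\<And>i. i \<in> I \<Longrightarrow> \<psi> i \<in> L2 M"
    and f: "f \<in> L2 M" and h: "h \<in> L2 M"
  shows "(AE p in N \<Otimes>\<^sub>M count_space I. sampling_op M g \<psi> f p = sampling_op M g \<psi> h p) \<longleftrightarrow>
    (AE x in M. \<forall>i\<in>I. cinner (f x - h x) (\<psi> i x) = 0)" (is "?L \<longleftrightarrow> ?R")
proof
  have g: "g s \<in> Linf M" if "s \<in> space N" for s
    using pars that by (simp add: parseval_determining_def)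
  have diff: "L2_inner M (f - h) (mult_op (g s) (\<psi> i)) =
      sampling_op M g \<psi> f (s, i) - sampling_op M g \<psi> h (s, i)" if "s \<in> space N" "i \<in> I" for s i
    unfolding sampling_op_def
    by (simp add: L2_inner_diff_left[OF f h mult_op_L2[OF g[OF that(1)] \<psi>[OF that(2)]]])
  have fh: "f - h \<in> L2 M" using f h by (rule L2_diff)
  {
    assume L: ?L
    interpret pair_sigma_finite N "count_space I"
      using N sigma_finite_measure_count_space_countable[OF I] by (rule pair_sigma_finite.intro)
    have AE_s: "AE s in N. AE i in count_space I.
        sampling_op M g \<psi> f (s, i) = sampling_op M g \<psi> h (s, i)"
      by (rule AE_pair) (rule L)
    have "AE x in M. cinner ((f - h) x) (\<psi> i x) = 0" if i: "i \<in> I" for i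
    proof (rule AE_orthogonal[OF pars fh \<psi>[OF i]])
      show "AE s in N. L2_inner M (f - h) (mult_op (g s) (\<psi> i)) = 0"
        using AE_s AE_space
      proof eventually_elim
        case (elim s)
        then show ?case using diff[OF _ i] i by (simp add: AE_count_space)
      qed
    qed
    then have "AE x in M. \<forall>i\<in>I. cinner ((f - h) x) (\<psi> i x) = 0"
      by (rule AE_ball_countable'[OF _ I])
    then show ?R by simp
  next
    assume R: ?R
    have "sampling_op M g \<psi> f (s, i) = sampling_op M g \<psi> h (s, i)"
      if s: "s \<in> space N" and i: "i \<in> I" for s i
    proof -
      have "L2_inner M (f - h) (mult_op (g s) (\<psi> i)) = 0"
        unfolding L2_inner_mult_op
        by (rule integral_eq_zero_AE, use R in eventually_elim) (use i in simp)
      then show ?thesis using diff[OF s i] by simp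
    qed
    then show ?L by (intro AE_I2) (auto simp: space_pair_measure)
  }
qed

text \<open>
  Instead of selecting kernel vectors measurably, project the sampling vectors: with \<open>p\<^sub>i\<close> the
  projection of \<open>\<psi>\<^sub>i\<close> onto \<open>V\<close>, the part of a generator \<open>\<phi>\<close> orthogonal to the MI span of the
  \<open>p\<^sub>i\<close> lies in \<open>V\<close> and is not seen by sampling, so it is \<open>0\<close>.  Hence almost every \<open>\<phi>(x)\<close> is in
  the closed span of the \<open>p\<^sub>i(x)\<close>, and a vector of the fibre space orthogonal to all \<open>\<psi>\<^sub>i(x)\<close>,
  equivalently to all \<open>p\<^sub>i(x)\<close>, is orthogonal to the whole fibre space.
\<close>

lemma fibrewise_injective:
  fixes \<psi> :: "'i \<Rightarrow> 'x \<Rightarrow> 'h::{complex_hilbert, second_countable_topology}"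
  assumes pars: "parseval_determining M N g" and B: "B \<subseteq> L2 M" "countable B"
    and I: "countable I" and \<psi>: "\<And>i. i \<in> I \<Longrightarrow> \<psi> i \<in> L2 M"
    and inj: "\<And>w. w \<in> MI_span M (g ` space N) B \<Longrightarrow>
      AE x in M. \<forall>i\<in>I. cinner (w x) (\<psi> i x) = 0 \<Longrightarrow> AE x in M. w x = 0"
  shows "AE x in M. \<forall>v\<in>fibre_space B x. (\<forall>i\<in>I. cinner v (\<psi> i x) = 0) \<longrightarrow> v = 0"
proof -
  let ?D = "g ` space N"
  note mem_iff = MI_span_iff_fibre_space[OF pars]
  have "\<forall>i\<in>I. \<exists>p. p \<in> MI_span M ?D B \<and>
      (AE x in M. \<forall>v\<in>fibre_space B x. cinner (\<psi> i x - p x) v = 0)"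
    using MI_span_projection[OF pars B \<psi>] by blast
  from bchoice[OF this] obtain p where p_all: "\<forall>i\<in>I. p i \<in> MI_span M ?D B \<and>
      (AE x in M. \<forall>v\<in>fibre_space B x. cinner (\<psi> i x - p i x) v = 0)" ..
  then have p: "\<And>i. i \<in> I \<Longrightarrow> p i \<in> MI_span M ?D B"
    and orth: "\<And>i. i \<in> I \<Longrightarrow> AE x in M. \<forall>v\<in>fibre_space B x. cinner (\<psi> i x - p i x) v = 0"
    by simp_all
  have P: "p ` I \<subseteq> L2 M" "countable (p ` I)" using subsetD[OF MI_span_subset_L2 p] I by auto
  have same: "AE x in M. \<forall>i\<in>I. \<forall>v\<in>fibre_space B x. cinner v (\<psi> i x) = cinner v (p i x)"
  proof (rule AE_ball_countable'[OF _ I])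
    fix i assume "i \<in> I"
    from orth[OF this] show "AE x in M. \<forall>v\<in>fibre_space B x. cinner v (\<psi> i x) = cinner v (p i x)"
    proof eventually_elim
      case (elim x)
      then have "\<forall>v\<in>fibre_space B x. cinner v (\<psi> i x - p i x) = 0"
        using cinner_eq_zero_sym by blast
      then show ?case by (simp add: cinner_diff_right)
    qed
  qed
  have p_fibre: "AE x in M. \<forall>i\<in>I. p i x \<in> fibre_space B x"
    by (rule AE_ball_countable'[OF _ I]) (use p mem_iff[OF B] in blast)
  have sub: "AE x in M. fibre_space (p ` I) x \<subseteq> fibre_space B x"
    using p_fibre
  proof eventually_elim
    case (elim x)
    have "cspan ((\<lambda>\<phi>. \<phi> x) ` p ` I) \<subseteq> fibre_space B x"
      by (intro complex_vector.span_minimal csubspace_fibre_space) (use elim in auto)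
    then show ?case
      unfolding fibre_space_def[of "p ` I"] by (rule closure_minimal[OF _ closed_fibre_space])
  qed
  have "AE x in M. \<phi> x \<in> fibre_space (p ` I) x" if \<phi>: "\<phi> \<in> B" for \<phi>
  proof -
    have \<phi>L2: "\<phi> \<in> L2 M" using \<phi> B by auto
    obtain q where q: "q \<in> MI_span M ?D (p ` I)"
      and q_orth: "AE x in M. \<forall>v\<in>fibre_space (p ` I) x. cinner (\<phi> x - q x) v = 0"
      using MI_span_projection[OF pars P \<phi>L2] by blast
    have q_fibre: "AE x in M. q x \<in> fibre_space (p ` I) x"
      using q mem_iff[OF P] by blast
    have diff_fibre: "AE x in M. (\<phi> - q) x \<in> fibre_space B x"
      using q_fibre sub
    proof eventually_elim
      case (elim x)
      then have "q x \<in> fibre_space B x" by blast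
      then have "\<phi> x - q x \<in> fibre_space B x"
        by (rule complex_vector.subspace_diff[OF csubspace_fibre_space fibre_space_base[OF \<phi>]])
      then show ?case by simp
    qed
    have "\<phi> - q \<in> L2 M" using \<phi>L2 q MI_span_subset_L2 by (intro L2_diff) auto
    with diff_fibre have "\<phi> - q \<in> MI_span M ?D B" by (simp add: mem_iff[OF B])
    moreover have "AE x in M. \<forall>i\<in>I. cinner ((\<phi> - q) x) (\<psi> i x) = 0"
      using q_orth diff_fibre same
    proof eventually_elim
      case (elim x)
      show ?case
      proof
        fix i assume i: "i \<in> I"
        have "cinner ((\<phi> - q) x) (\<psi> i x) = cinner ((\<phi> - q) x) (p i x)"
          using elim i by blast
        also have "\<dots> = 0"
          using elim(1) fibre_space_base[of "p i" "p ` I" x] i by simp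
        finally show "cinner ((\<phi> - q) x) (\<psi> i x) = 0" .
      qed
    qed
    ultimately have "AE x in M. (\<phi> - q) x = 0" by (rule inj)
    with q_fibre show ?thesis by eventually_elim simp
  qed
  then have "AE x in M. \<forall>\<phi>\<in>B. \<phi> x \<in> fibre_space (p ` I) x"
    by (rule AE_ball_countable'[OF _ B(2)])
  with same show ?thesis
  proof eventually_elim
    case (elim x)
    show ?case
    proof (intro ballI impI)
      fix v assume v: "v \<in> fibre_space B x" and zero: "\<forall>i\<in>I. cinner v (\<psi> i x) = 0"
      have "cinner v (\<phi> x) = 0" if "\<phi> \<in> B" for \<phi>
      proof (rule orthogonal_fibre_space)
        show "\<phi> x \<in> fibre_space (p ` I) x" using elim(2) that by blast
        show "cinner v (\<eta> x) = 0" if "\<eta> \<in> p ` I" for \<eta>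
          using that elim(1) v zero by auto
      qed
      then have "cinner v v = 0" using v by (rule orthogonal_fibre_space)
      then show "v = 0" by (simp add: cinner_eq_zero_iff)
    qed
  qed
qed

lemma one_to_one_for_MI_span_iff:
  fixes \<psi> :: "'i \<Rightarrow> 'x \<Rightarrow> 'h::{complex_hilbert, second_countable_topology}"
  assumes pars: "parseval_determining M N g" and N: "sigma_finite_measure N"
    and I: "countable I" and \<psi>: "\<And>i. i \<in> I \<Longrightarrow> \<psi> i \<in> L2 M"
    and B: "set \<phi>s \<subseteq> L2 M"
  shows "one_to_one_for M (N \<Otimes>\<^sub>M count_space I) (sampling_op M g \<psi>)
      {MI_span M (g ` space N) (set \<phi>s)} \<longleftrightarrow>
    (AE x in M. cdim (range (mixed_gramian \<phi>s I \<psi> x)) = cdim (fibre_space (set \<phi>s) x))"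
    (is "?L \<longleftrightarrow> ?R")
proof
  let ?V = "MI_span M (g ` space N) (set \<phi>s)"
  have B': "countable (set \<phi>s)" by (simp add: countable_finite)
  note mem_iff = MI_span_iff_fibre_space[OF pars B B']
  note sampling_iff = sampling_op_eq_iff[OF pars N I \<psi>]
  {
    assume L: ?L
    have null: "AE x in M. w x = 0"
      if w: "w \<in> ?V" and zero: "AE x in M. \<forall>i\<in>I. cinner (w x) (\<psi> i x) = 0" for w
    proof -
      have "(0 :: 'x \<Rightarrow> 'h) \<in> ?V"
        unfolding mem_iff by (simp add: L2_zero complex_vector.subspace_0[OF csubspace_fibre_space])
      moreover have "AE z in N \<Otimes>\<^sub>M count_space I. sampling_op M g \<psi> w z = sampling_op M g \<psi> 0 z"
        using zero w MI_span_subset_L2 by (subst sampling_iff) (auto simp: L2_zero)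
      ultimately have "AE x in M. w x = (0 :: 'x \<Rightarrow> 'h) x"
        using L w unfolding one_to_one_for_def by blast
      then show ?thesis by simp
    qed
    have "AE x in M. \<forall>v\<in>fibre_space (set \<phi>s) x. (\<forall>i\<in>I. cinner v (\<psi> i x) = 0) \<longrightarrow> v = 0"
      by (rule fibrewise_injective[OF pars B B' I]) (fact \<psi> null)+
    then show ?R by (simp only: cdim_range_mixed_gramian_iff)
  next
    assume ?R
    then have ker: "AE x in M. \<forall>v\<in>fibre_space (set \<phi>s) x. (\<forall>i\<in>I. cinner v (\<psi> i x) = 0) \<longrightarrow> v = 0"
      by (simp only: cdim_range_mixed_gramian_iff)
    have "AE x in M. f x = h x"
      if f: "f \<in> ?V" and h: "h \<in> ?V"
        and eq: "AE z in N \<Otimes>\<^sub>M count_space I. sampling_op M g \<psi> f z = sampling_op M g \<psi> h z" for f h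
    proof -
      have "AE x in M. \<forall>i\<in>I. cinner (f x - h x) (\<psi> i x) = 0"
        using eq f h MI_span_subset_L2 by (subst (asm) sampling_iff) auto
      moreover have "AE x in M. f x \<in> fibre_space (set \<phi>s) x" using f mem_iff by blast
      moreover have "AE x in M. h x \<in> fibre_space (set \<phi>s) x" using h mem_iff by blast
      ultimately show ?thesis using ker
      proof eventually_elim
        case (elim x)
        then have "f x - h x \<in> fibre_space (set \<phi>s) x"
          by (intro complex_vector.subspace_diff[OF csubspace_fibre_space])
        with elim have "f x - h x = 0" by blast
        then show ?case by simp
      qed
    qed
    then show ?L by (auto simp: one_to_one_for_def)
  }
qed

theorem theorem4p4:
  fixes M :: "'x measure" and N :: "'s measure"
    and g :: "'s \<Rightarrow> 'x \<Rightarrow> complex"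
    and \<Delta> :: "'d set"
    and \<N> :: "'d \<Rightarrow> ('x \<Rightarrow> 'h::{complex_hilbert, second_countable_topology}) set"
    and I :: "'i set" and \<psi> :: "'i \<Rightarrow> 'x \<Rightarrow> 'h"
    and A' :: "'d \<Rightarrow> 'd \<Rightarrow> ('x \<Rightarrow> 'h) list"
  assumes "sigma_finite_measure M" and "complete_measure M" and "L2_separable M"
    and "sigma_finite_measure N"
    and "parseval_determining M N g"
    and "\<And>\<delta>. \<delta> \<in> \<Delta> \<Longrightarrow> finitely_generated_MI M (g ` space N) (\<N> \<delta>)"
    and "countable I" and "\<And>i. i \<in> I \<Longrightarrow> \<psi> i \<in> L2 M"
    and "MI_bessel M N g I \<psi>"
    and "\<And>\<delta> \<theta>. \<delta> \<in> \<Delta> \<Longrightarrow> \<theta> \<in> \<Delta> \<Longrightarrow> \<delta> \<noteq> \<theta> \<Longrightarrow> sup_cos_angle M (\<N> \<delta>) (\<N> \<theta>) < 1"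
    and "\<And>\<delta> \<theta>. \<delta> \<in> \<Delta> \<Longrightarrow> \<theta> \<in> \<Delta> \<Longrightarrow>
      finite_generators M (g ` space N) (set (A' \<delta> \<theta>)) (sum_space (\<N> \<delta>) (\<N> \<theta>))"
  shows "one_to_one_for M (N \<Otimes>\<^sub>M count_space I) (sampling_op M g \<psi>)
      {sum_space (\<N> \<delta>) (\<N> \<theta>) | \<delta> \<theta>. \<delta> \<in> \<Delta> \<and> \<theta> \<in> \<Delta>} \<longleftrightarrow>
    (\<forall>\<delta>\<in>\<Delta>. \<forall>\<theta>\<in>\<Delta>. AE x in M.
      cdim (range (mixed_gramian (A' \<delta> \<theta>) I \<psi> x)) = cdim (fibre_space (set (A' \<delta> \<theta>)) x))"
proof -
  have "one_to_one_for M (N \<Otimes>\<^sub>M count_space I) (sampling_op M g \<psi>) {sum_space (\<N> \<delta>) (\<N> \<theta>)} \<longleftrightarrow>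
      (AE x in M. cdim (range (mixed_gramian (A' \<delta> \<theta>) I \<psi> x)) =
        cdim (fibre_space (set (A' \<delta> \<theta>)) x))" if "\<delta> \<in> \<Delta>" "\<theta> \<in> \<Delta>" for \<delta> \<theta>
  proof -
    have B: "set (A' \<delta> \<theta>) \<subseteq> L2 M"
      and eq: "sum_space (\<N> \<delta>) (\<N> \<theta>) = MI_span M (g ` space N) (set (A' \<delta> \<theta>))"
      using assms(11)[OF that] by (auto simp: finite_generators_def)
    show ?thesis
      unfolding eq by (rule one_to_one_for_MI_span_iff[OF assms(5,4,7,8) B])
  qed
  moreover have "one_to_one_for M (N \<Otimes>\<^sub>M count_space I) (sampling_op M g \<psi>)
      {sum_space (\<N> \<delta>) (\<N> \<theta>) | \<delta> \<theta>. \<delta> \<in> \<Delta> \<and> \<theta> \<in> \<Delta>} \<longleftrightarrow>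
    (\<forall>\<delta>\<in>\<Delta>. \<forall>\<theta>\<in>\<Delta>.
      one_to_one_for M (N \<Otimes>\<^sub>M count_space I) (sampling_op M g \<psi>) {sum_space (\<N> \<delta>) (\<N> \<theta>)})"
    unfolding one_to_one_for_def by blast
  ultimately show ?thesis by simp
qed

end
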